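(* Let $\Omega$, $p,q$, $k_0$, $k_\star$, $\mathcal{V}_0$, $\mathcal{V}_\star$, and $\mathcal{V}=\mathcal{V}_0+\mathcal{V}_\star$ be as in the context. Suppose that there are real constants $\tau>0$, $\gamma>0$, $\lambda_\Delta$ and a constant $M$ such that: (i) $k_0(a,a)-\tau/a$ is bounded on a neighborhood of $0$ in $\Omega$, and for each $\sigma>\tau$ there is a neighborhood of $(0,0)$ in $\Omega^2$ on which $|k_0(a,a')|<\sigma/|a|$; (ii) $|k_0(a,a')|\le \dfrac{M}{|a|}\,e^{\lambda_\Delta|a-a'|}$ for all $a,a'\in\Omega$; (iii) $|k_\star(a,a')|\le M\,\dfrac{|a-a'|^\gamma}{|a|}\,e^{\lambda_\Delta|a-a'|}$ for all $a,a'\in\Omega$. Fix $b\in\Omega$ and let $f_0(a)=\frac{1}{p(a)}\exp\left(-\int_b^a\frac{q(s)}{p(s)}\,ds\right)$, which belongs to $\mathcal{H}L^\infty_{\tau-1,\bullet}(\Omega)$. Then the equation $f=\mathcal{V}f$ has a unique solution $f$ in the affine subspace $$f_0+\mathcal{H}L^\infty_{\tau-1+\gamma,\bullet}(\Omega)$$ of $\mathcal{H}L^\infty_{\tau-1,\bullet}(\Omega)$.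
   Context: $\Omega\subset\mathbb{C}$ is a simply connected open set with $0\notin\Omega$ and $0\in\overline{\Omega}$, star-shaped around $0$: for every $a\in\Omega$ the segment $\{ta: 0<t\le 1\}$ lies in $\Omega$. $\mathcal{H}(\Omega)$ is the space of holomorphic functions on $\Omega$. The functions $p,q\in\mathcal{H}(\Omega)$ are such that $k_0(a,a')=-q(a')/p(a)$ is holomorphic on $\Omega^2$ (so $p$ has no zeros in $\Omega$ when $q\not\equiv0$), and $k_\star$ is a holomorphic function on $\Omega^2$. The Volterra operators are $[\mathcal{V}_0\varphi](a)=\int_0^a k_0(a,a')\varphi(a')\,da'$ and $[\mathcal{V}_\star\varphi](a)=\int_0^a k_\star(a,a')\varphi(a')\,da'$. Integrals $\int_0^a$ are (possibly improper at $0$) integrals along the straight segment from $0$ to $a$. Integrals $\int_b^a$ with $b\in\Omega$ are taken along any path in $\Omega$. A neighborhood of $0$ in $\Omega$ means $U\cap\Omega$ with $U\subset\mathbb{C}$ an open neighborhood of $0$, and similarly a neighborhood of $(0,0)$ in $\Omega^2$ means $U\cap\Omega^2$ with $U\subset\mathbb{C}^2$ an open neighborhood of $(0,0)$. For $\sigma,\Lambda\in\mathbb{R}$, $\mathcal{H}L^\infty_{\sigma,\Lambda}(\Omega)$ is the space of $f\in\mathcal{H}(\Omega)$ with $\|f\|_{\sigma,\Lambda}:=\sup_{a\in\Omega}|a|^{-\sigma}e^{-\Lambda|a|}|f(a)|<\infty$, and $\mathcal{H}L^\infty_{\sigma,\bullet}(\Omega)=\bigcup_{\Lambda\in\mathbb{R}}\mathcal{H}L^\infty_{\sigma,\Lambda}(\Omega)$.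 *)

theory Defs
  imports "HOL-Complex_Analysis.Complex_Analysis"
begin

text \<open>Joint holomorphy in two complex variables: complex Frechet differentiability at every
  point, i.e. the real derivative exists and is complex-linear.\<close>

definition holomorphic2_on :: "(complex \<times> complex \<Rightarrow> complex) \<Rightarrow> (complex \<times> complex) set \<Rightarrow> bool"
    (infixl \<open>holomorphic2'_on\<close> 50) where
  "f holomorphic2_on S \<longleftrightarrow>
     (\<forall>z\<in>S. \<exists>A B. (f has_derivative (\<lambda>h. A * fst h + B * snd h)) (at z within S))"

definition star_shaped_0 :: "complex set \<Rightarrow> bool" where
  "star_shaped_0 \<Omega> \<longleftrightarrow> (\<forall>a\<in>\<Omega>. \<forall>t::real. 0 < t \<and> t \<le> 1 \<longrightarrow> of_real t * a \<in> \<Omega>)"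

text \<open>Functions on \<open>\<Omega>\<close> are represented by total functions whose values outside \<open>\<Omega>\<close> are irrelevant.
  Boundedness of the image set says that the weighted supremum is finite.\<close>

definition HLinf :: "complex set \<Rightarrow> real \<Rightarrow> real \<Rightarrow> (complex \<Rightarrow> complex) set" where
  "HLinf \<Omega> \<sigma> \<Lambda> =
     {f. f holomorphic_on \<Omega> \<and>
         bdd_above ((\<lambda>a. norm a powr (- \<sigma>) * exp (- \<Lambda> * norm a) * norm (f a)) ` \<Omega>)}"

definition HLinf_union :: "complex set \<Rightarrow> real \<Rightarrow> (complex \<Rightarrow> complex) set" where
  "HLinf_union \<Omega> \<sigma> = (\<Union>\<Lambda>. HLinf \<Omega> \<sigma> \<Lambda>)"

definition kernel0 :: "(complex \<Rightarrow> complex) \<Rightarrow> (complex \<Rightarrow> complex) \<Rightarrow> complex \<Rightarrow> complex \<Rightarrow> complex" where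
  "kernel0 p q a a' = - q a' / p a"

text \<open>The library's contour integral along a segment is a Henstock-Kurzweil integral over \<open>[0,1]\<close>.
  By Hake's theorem it therefore includes integrals that are improper at the endpoint \<open>0\<close>; the
  value of the integrand at the single point \<open>0\<close> plays no role.\<close>

definition volterra ::
    "(complex \<Rightarrow> complex \<Rightarrow> complex) \<Rightarrow> (complex \<Rightarrow> complex) \<Rightarrow> complex \<Rightarrow> complex" where
  "volterra k \<phi> a = contour_integral (linepath 0 a) (\<lambda>a'. k a a' * \<phi> a')"

text \<open>The equation \<open>f = \<V>\<^sub>0 f + \<V>\<^sub>\<star> f\<close> on \<open>\<Omega>\<close>. Because a divergent contour integral has the default value
  \<open>0\<close>, convergence of both integrals is demanded explicitly.\<close>

definition volterra_solution ::
    "complex set \<Rightarrow> (complex \<Rightarrow> complex \<Rightarrow> complex) \<Rightarrow> (complex \<Rightarrow> complex \<Rightarrow> complex)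
      \<Rightarrow> (complex \<Rightarrow> complex) \<Rightarrow> bool" where
  "volterra_solution \<Omega> k0 ks f \<longleftrightarrow>
     (\<forall>a\<in>\<Omega>. (\<lambda>a'. k0 a a' * f a') contour_integrable_on linepath 0 a \<and>
            (\<lambda>a'. ks a a' * f a') contour_integrable_on linepath 0 a \<and>
            f a = volterra k0 f a + volterra ks f a)"

text \<open>The integral from \<open>b\<close> to \<open>a\<close> along a chosen path in \<open>\<Omega>\<close>. For holomorphic \<open>g\<close> on a simply connected
  open \<open>\<Omega>\<close> the choice is immaterial by Cauchy's theorem.\<close>

definition integral_in :: "complex set \<Rightarrow> complex \<Rightarrow> complex \<Rightarrow> (complex \<Rightarrow> complex) \<Rightarrow> complex" where
  "integral_in \<Omega> b a g =
     contour_integral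
       (SOME \<gamma>. valid_path \<gamma> \<and> path_image \<gamma> \<subseteq> \<Omega> \<and> pathstart \<gamma> = b \<and> pathfinish \<gamma> = a) g"

definition f0_fun ::
    "complex set \<Rightarrow> (complex \<Rightarrow> complex) \<Rightarrow> (complex \<Rightarrow> complex) \<Rightarrow> complex \<Rightarrow> complex \<Rightarrow> complex" where
  "f0_fun \<Omega> p q b a = 1 / p a * exp (- integral_in \<Omega> b a (\<lambda>s. q s / p s))"

definition affine_HL :: "complex set \<Rightarrow> (complex \<Rightarrow> complex) \<Rightarrow> real \<Rightarrow> (complex \<Rightarrow> complex) set" where
  "affine_HL \<Omega> f0 \<sigma> = (\<lambda>h a. f0 a + h a) ` HLinf_union \<Omega> \<sigma>"

end

theory Submission
  imports Defs
begin

text \<open>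
  The function \<open>f\<^sub>0\<close> is annihilated by the differential operator behind \<open>1 - \<V>\<^sub>0\<close>, since \<open>(p f\<^sub>0)' = - q f\<^sub>0\<close>;
  as \<open>p f\<^sub>0\<close> vanishes at \<open>0\<close>, it is a fixed point of \<open>\<V>\<^sub>0\<close>. Hence \<open>f = f\<^sub>0 + h\<close> solves \<open>f = \<V> f\<close> iff
  \<open>h = \<V>\<^sub>\<star> f\<^sub>0 + \<V> h\<close>, and \<open>\<V>\<^sub>\<star>\<close> improves the exponent by \<open>\<gamma>\<close>. On functions of size \<open>|a|\<^bsup>s-1\<^esup> exp (\<Lambda> |a|)\<close>
  with \<open>s > \<tau>\<close> the operator \<open>\<V>\<close> is a contraction for large \<open>\<Lambda>\<close>: near \<open>0\<close> the bound
  \<open>|k\<^sub>0(a,a')| < \<sigma> / |a|\<close> with \<open>\<tau> < \<sigma> < s\<close> gives the factor \<open>\<sigma> / s\<close>, while away from \<open>0\<close>, and for \<open>k\<^sub>\<star>\<close>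
  everywhere, the exponential weight makes the factor as small as desired. A Neumann series then
  yields \<open>h\<close>.
\<close>


section \<open>Integrals depending on a parameter\<close>

text \<open>Morera's theorem: by Fubini the integral of \<open>?F\<close> over a triangle is the
  integral over \<open>t\<close> of the triangle integrals of \<open>\<lambda>a. G a t\<close>, and
  these vanish by Cauchy's theorem.\<close>

lemma holomorphic_on_integral_param:
  fixes G :: "complex \<Rightarrow> real \<Rightarrow> complex"
  assumes "open S"
    and cont: "continuous_on (S \<times> {c..d}) (\<lambda>(a, t). G a t)"
    and hol: "\<And>t. t \<in> {c..d} \<Longrightarrow> (\<lambda>a. G a t) holomorphic_on S"
  shows "(\<lambda>a. integral {c..d} (G a)) holomorphic_on S"
proof -
  let ?F = "\<lambda>a. integral {c..d} (G a)"
  have contF: "continuous_on S ?F"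
    using integral_continuous_on_param[of S c d G] cont by simp
  \<comment> \<open>Fubini along one side of a triangle; joint continuity of the integrand on a
    compact rectangle justifies the exchange.\<close>
  have seg: "contour_integral (linepath x y) ?F
      = integral {c..d} (\<lambda>t. contour_integral (linepath x y) (\<lambda>a. G a t))"
    if "closed_segment x y \<subseteq> S" for x y
  proof -
    have ci: "contour_integral (linepath x y) f = integral {0..1} (\<lambda>u. f (linepath x y u) * (y - x))" for f
      by (simp add: contour_integral_integral)
    have mem: "(1 - u) *\<^sub>R x + u *\<^sub>R y \<in> S" if "0 \<le> u" "u \<le> 1" for u
      using \<open>closed_segment x y \<subseteq> S\<close> that by (auto simp: closed_segment_def)
    have "continuous_on (cbox (0, c) (1, d)) (\<lambda>z. (\<lambda>(a, t). G a t) (linepath x y (fst z), snd z))"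
      by (rule continuous_on_compose2[OF cont])
         (auto intro!: continuous_intros mem simp: cbox_Pair_eq linepath_def)
    then have "continuous_on (cbox (0, c) (1, d)) (\<lambda>(u, t). G (linepath x y u) t * (y - x))"
      by (auto intro!: continuous_intros simp: case_prod_unfold)
    from integral_swap_continuous[OF this]
    have "integral {0..1} (\<lambda>u. integral {c..d} (\<lambda>t. G (linepath x y u) t * (y - x)))
        = integral {c..d} (\<lambda>t. integral {0..1} (\<lambda>u. G (linepath x y u) t * (y - x)))"
      by simp
    then show ?thesis
      by (simp add: ci)
  qed
  have "?F analytic_on S"
  proof (rule Morera_triangle[OF contF \<open>open S\<close>], intro impI)
    fix x y z assume tri: "convex hull {x, y, z} \<subseteq> S"
    then have sub: "closed_segment x y \<subseteq> S" "closed_segment y z \<subseteq> S" "closed_segment z x \<subseteq> S"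
      by (meson convex_hull_subset order_trans segments_subset_convex_hull)+
    have int: "(\<lambda>t. contour_integral (linepath u v) (\<lambda>a. G a t)) integrable_on {c..d}"
      if "closed_segment u v \<subseteq> S" for u v
    proof -
      have mem: "(1 - r) *\<^sub>R u + r *\<^sub>R v \<in> S" if "0 \<le> r" "r \<le> 1" for r
        using \<open>closed_segment u v \<subseteq> S\<close> that by (auto simp: closed_segment_def)
      have "continuous_on ({c..d} \<times> cbox 0 1) (\<lambda>z. (\<lambda>(a, t). G a t) (linepath u v (snd z), fst z))"
        by (rule continuous_on_compose2[OF cont])
           (auto intro!: continuous_intros mem simp: linepath_def)
      then have "continuous_on ({c..d} \<times> cbox 0 1) (\<lambda>(t, r). G (linepath u v r) t * (v - u))"
        by (auto intro!: continuous_intros simp: case_prod_unfold)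
      from integral_continuous_on_param[OF this] show ?thesis
        by (intro integrable_continuous_interval) (simp add: contour_integral_integral)
    qed
    have 0: "contour_integral (linepath x y) (\<lambda>a. G a t) + contour_integral (linepath y z) (\<lambda>a. G a t)
        + contour_integral (linepath z x) (\<lambda>a. G a t) = 0" if "t \<in> {c..d}" for t
    proof -
      have h: "(\<lambda>a. G a t) holomorphic_on S" by (rule hol[OF that])
      then have ci: "(\<lambda>a. G a t) contour_integrable_on linepath u v" if "closed_segment u v \<subseteq> S" for u v
        using that by (meson contour_integrable_continuous_linepath continuous_on_subset holomorphic_on_imp_continuous_on)
      have "((\<lambda>a. G a t) has_contour_integral 0) (linepath x y +++ linepath y z +++ linepath z x)"
        using Cauchy_theorem_triangle h holomorphic_on_subset tri by blast
      then have "contour_integral (linepath x y +++ linepath y z +++ linepath z x) (\<lambda>a. G a t) = 0"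
        using contour_integral_unique by blast
      then show ?thesis
        using ci sub by (simp add: contour_integrable_joinI valid_path_join algebra_simps)
    qed
    show "contour_integral (linepath x y) ?F + contour_integral (linepath y z) ?F
        + contour_integral (linepath z x) ?F = 0"
      using sub integral_cong[of "{c..d}" _ "\<lambda>_. 0", OF 0] by (simp add: seg int integrable_add flip: integral_add)
  qed
  then show ?thesis
    using analytic_imp_holomorphic by blast
qed

lemma holomorphic2_on_imp_continuous_on: "f holomorphic2_on S \<Longrightarrow> continuous_on S f"
  unfolding holomorphic2_on_def continuous_on_eq_continuous_within
  using has_derivative_continuous by blast

text \<open>Chain rule along the complex line \<open>x \<mapsto> (x, c * x)\<close>: the
  complex-linear derivative \<open>A, B\<close> pulls back to multiplication by
  \<open>A + B * c\<close>.\<close>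

lemma holomorphic2_on_compose_ray:
  assumes "(\<lambda>(a, a'). k a a') holomorphic2_on \<Omega> \<times> \<Omega>" "\<And>a. a \<in> \<Omega> \<Longrightarrow> c * a \<in> \<Omega>"
  shows "(\<lambda>a. k a (c * a)) holomorphic_on \<Omega>"
  unfolding holomorphic_on_def field_differentiable_def
proof
  fix a assume a: "a \<in> \<Omega>"
  then obtain A B where *: "((\<lambda>(a, a'). k a a') has_derivative (\<lambda>h. A * fst h + B * snd h))
      (at (a, c * a) within \<Omega> \<times> \<Omega>)"
    using assms unfolding holomorphic2_on_def by blast
  have d: "((\<lambda>x. (x, c * x)) has_derivative (\<lambda>h. (h, c * h))) (at a within \<Omega>)"
    by (auto intro!: derivative_eq_intros)
  have "((\<lambda>(a, a'). k a a') has_derivative (\<lambda>h. A * fst h + B * snd h))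
      (at (a, c * a) within (\<lambda>x. (x, c * x)) ` \<Omega>)"
    by (rule has_derivative_subset[OF *]) (use assms(2) in auto)
  from has_derivative_in_compose[OF d this]
  have "((\<lambda>a. k a (c * a)) has_derivative (\<lambda>h. A * h + B * (c * h))) (at a within \<Omega>)"
    by simp
  moreover have "(\<lambda>h. A * h + B * (c * h)) = (*) (A + B * c)"
    by (auto simp: algebra_simps)
  ultimately have "((\<lambda>a. k a (c * a)) has_field_derivative (A + B * c)) (at a within \<Omega>)"
    by (simp add: has_field_derivative_def)
  then show "\<exists>f'. ((\<lambda>a. k a (c * a)) has_field_derivative f') (at a within \<Omega>)" by blast
qed

text \<open>The substitution \<open>a' = t * a\<close> moves the integral to the fixed interval
  \<open>{0..1}\<close>, so that \<open>a\<close> enters only as a parameter.\<close>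

lemma volterra_eq_integral:
  "volterra k \<phi> a = integral {0..1} (\<lambda>t. k a (of_real t * a) * \<phi> (of_real t * a) * a)"
  by (simp add: volterra_def contour_integral_integral linepath_def scaleR_conv_of_real)

lemma contour_integrable_on_ray:
  "f contour_integrable_on linepath 0 a \<longleftrightarrow> (\<lambda>t. f (of_real t * a) * a) integrable_on {0..1}"
  by (simp add: contour_integrable_on linepath_def scaleR_conv_of_real)

text \<open>The form needed for integrals improper at 0: continuity on the half-open interval gives
  measurability, the majorant gives integrability, and the single point 0 is negligible.\<close>

lemma integrable_continuous_dominated:
  fixes F :: "real \<Rightarrow> 'a :: euclidean_space"
  assumes cont: "continuous_on {0<..c} F" and g: "g integrable_on {0..c}"
    and le: "\<And>t. 0 < t \<Longrightarrow> t \<le> c \<Longrightarrow> norm (F t) \<le> g t"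
  shows "F integrable_on {0..c}" and "norm (integral {0..c} F) \<le> integral {0..c} g"
proof -
  have sp: "f integrable_on {0<..c} \<longleftrightarrow> f integrable_on {0..c}"
    "integral {0<..c} f = integral {0..c} f" for f :: "real \<Rightarrow> 'b :: banach"
    by (intro integrable_spike_set_eq integral_spike_set negligible_subset[OF negligible_sing[of 0]]; auto)+
  have "F \<in> borel_measurable (lebesgue_on {0<..c})"
    using cont by (rule continuous_imp_measurable_on_sets_lebesgue) auto
  then have F: "F integrable_on {0<..c}"
    by (rule measurable_bounded_by_integrable_imp_integrable) (use g le in \<open>auto simp: sp\<close>)
  then show "F integrable_on {0..c}" by (simp add: sp)
  have "norm (integral {0<..c} F) \<le> integral {0<..c} g"
    by (rule integral_norm_bound_integral[OF F]) (use g le in \<open>auto simp: sp\<close>)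
  then show "norm (integral {0..c} F) \<le> integral {0..c} g" by (simp add: sp)
qed

section \<open>Volterra operators on a star-shaped domain\<close>

locale punctured_star =
  fixes \<Omega> :: "complex set"
  assumes open_\<Omega>: "open \<Omega>" and zero_notin: "0 \<notin> \<Omega>" and star: "star_shaped_0 \<Omega>"
begin

lemma ray: "a \<in> \<Omega> \<Longrightarrow> 0 < t \<Longrightarrow> t \<le> 1 \<Longrightarrow> of_real t * a \<in> \<Omega>"
  using star by (auto simp: star_shaped_0_def)

lemma continuous_on_ray_integrand:
  assumes k: "(\<lambda>(a, a'). k a a') holomorphic2_on \<Omega> \<times> \<Omega>" and \<phi>: "\<phi> holomorphic_on \<Omega>"
  shows "continuous_on (\<Omega> \<times> {0<..1}) (\<lambda>(a, t). k a (of_real t * a) * \<phi> (of_real t * a) * a)"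
proof -
  have "continuous_on (\<Omega> \<times> {0<..1}) (\<lambda>z. (\<lambda>(a, a'). k a a') (fst z, of_real (snd z) * fst z))"
    by (rule continuous_on_compose2[OF holomorphic2_on_imp_continuous_on[OF k]])
       (auto intro!: continuous_intros ray)
  moreover have "continuous_on (\<Omega> \<times> {0<..1}) (\<lambda>z. \<phi> (of_real (snd z) * fst z))"
    by (rule continuous_on_compose2[OF holomorphic_on_imp_continuous_on[OF \<phi>]])
       (auto intro!: continuous_intros ray)
  ultimately show ?thesis
    by (auto intro!: continuous_intros simp: case_prod_unfold)
qed

lemma volterra_dominated:
  assumes k: "(\<lambda>(a, a'). k a a') holomorphic2_on \<Omega> \<times> \<Omega>" and \<phi>: "\<phi> holomorphic_on \<Omega>"
    and a: "a \<in> \<Omega>" and g: "g integrable_on {0..1}"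
    and le: "\<And>t. 0 < t \<Longrightarrow> t \<le> 1 \<Longrightarrow> norm (k a (of_real t * a) * \<phi> (of_real t * a) * a) \<le> g t"
  shows "(\<lambda>a'. k a a' * \<phi> a') contour_integrable_on linepath 0 a"
    and "norm (volterra k \<phi> a) \<le> integral {0..1} g"
proof -
  have "continuous_on {0<..1} (\<lambda>t. (\<lambda>(a, t). k a (of_real t * a) * \<phi> (of_real t * a) * a) (a, t))"
    by (rule continuous_on_compose2[OF continuous_on_ray_integrand[OF k \<phi>]])
       (use a in \<open>auto intro!: continuous_intros\<close>)
  then have "continuous_on {0<..1} (\<lambda>t. k a (of_real t * a) * \<phi> (of_real t * a) * a)" by simp
  from integrable_continuous_dominated[OF this g le]
  show "(\<lambda>a'. k a a' * \<phi> a') contour_integrable_on linepath 0 a"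
    and "norm (volterra k \<phi> a) \<le> integral {0..1} g"
    by (auto simp: contour_integrable_on_ray volterra_eq_integral)
qed

text \<open>Integrals cut off near \<open>t = 0\<close> are holomorphic in \<open>a\<close>. They
  converge locally uniformly, since the omitted piece is at most
  \<open>E a * (\<delta> n powr s / s)\<close> and \<open>E\<close> is bounded on compact
  balls.\<close>

lemma volterra_holomorphic:
  assumes k: "(\<lambda>(a, a'). k a a') holomorphic2_on \<Omega> \<times> \<Omega>" and \<phi>: "\<phi> holomorphic_on \<Omega>"
    and E: "continuous_on \<Omega> E" and "s > 0"
    and le: "\<And>a t. a \<in> \<Omega> \<Longrightarrow> 0 < t \<Longrightarrow> t \<le> 1 \<Longrightarrow>
      norm (k a (of_real t * a) * \<phi> (of_real t * a) * a) \<le> E a * t powr (s - 1)"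
  shows "volterra k \<phi> holomorphic_on \<Omega>"
proof (rule holomorphic_uniform_sequence[OF open_\<Omega>])
  define G where "G a t = k a (of_real t * a) * \<phi> (of_real t * a) * a" for a t
  define \<delta> where "\<delta> n = inverse (real (Suc n))" for n
  have \<delta>: "0 < \<delta> n" "\<delta> n \<le> 1" for n
    by (auto simp: \<delta>_def inverse_le_1_iff)
  let ?F = "\<lambda>n a. integral {\<delta> n..1} (G a)"
  have contG: "continuous_on (\<Omega> \<times> {0<..1}) (\<lambda>(a, t). G a t)"
    unfolding G_def by (rule continuous_on_ray_integrand[OF k \<phi>])
  show "?F n holomorphic_on \<Omega>" for n
  proof (rule holomorphic_on_integral_param[OF open_\<Omega>])
    show "continuous_on (\<Omega> \<times> {\<delta> n..1}) (\<lambda>(a, t). G a t)"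
      using \<delta>[of n] by (intro continuous_on_subset[OF contG]) auto
    fix t assume t: "t \<in> {\<delta> n..1}"
    then have t: "0 < t" "t \<le> 1" using \<delta>[of n] by auto
    have "(\<lambda>a. \<phi> (of_real t * a)) holomorphic_on \<Omega>"
      using holomorphic_on_compose_gen[of "\<lambda>a. of_real t * a" \<Omega> \<phi> \<Omega>] \<phi> ray t
      by (auto simp: o_def intro!: holomorphic_intros)
    then show "(\<lambda>a. G a t) holomorphic_on \<Omega>"
      unfolding G_def
      by (intro holomorphic_intros holomorphic2_on_compose_ray[OF k]) (use ray t in auto)
  qed
  fix x assume "x \<in> \<Omega>"
  then obtain d where d: "d > 0" "cball x d \<subseteq> \<Omega>"
    using open_\<Omega> open_contains_cball by blast
  have "compact (E ` cball x d)"
    by (intro compact_continuous_image continuous_on_subset[OF E] d) auto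
  then obtain B where B: "\<And>a. a \<in> cball x d \<Longrightarrow> \<bar>E a\<bar> \<le> B"
    using compact_imp_bounded bounded_iff by (metis imageI real_norm_def)
  \<comment> \<open>The error of the cut-off, with a constant \<open>B\<close> that is uniform over
    the ball.\<close>
  have diff: "norm (?F n a - volterra k \<phi> a) \<le> B * (\<delta> n powr s / s)" if a: "a \<in> cball x d" for n a
  proof -
    have aO: "a \<in> \<Omega>" using a d by auto
    have pow: "((\<lambda>t. t powr (s - 1)) has_integral (c powr s / s)) {0..c}" if "c \<ge> 0" for c
      using has_integral_powr_from_0[of "s - 1" c] that \<open>s > 0\<close> by simp
    have "continuous_on {0<..1} (\<lambda>t. (\<lambda>(a, t). G a t) (a, t))"
      by (rule continuous_on_compose2[OF contG]) (use aO in \<open>auto intro!: continuous_intros\<close>)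
    then have contGa: "continuous_on {0<..1} (G a)" by simp
    have Ec: "(\<lambda>t. E a * t powr (s - 1)) integrable_on {0..c}" if "c \<ge> 0" for c
      using pow[OF that] by (intro integrable_on_mult_right) auto
    have int: "G a integrable_on {0..1}"
      by (rule integrable_continuous_dominated(1)[OF contGa Ec]) (use le aO in \<open>auto simp: G_def\<close>)
    have "volterra k \<phi> a = integral {0..\<delta> n} (G a) + ?F n a"
      unfolding volterra_eq_integral G_def[symmetric]
      using \<delta>[of n] by (intro Henstock_Kurzweil_Integration.integral_combine[symmetric] int) auto
    then have "norm (?F n a - volterra k \<phi> a) = norm (integral {0..\<delta> n} (G a))"
      by simp
    also have "\<dots> \<le> integral {0..\<delta> n} (\<lambda>t. E a * t powr (s - 1))"
      by (rule integrable_continuous_dominated(2)[OF continuous_on_subset[OF contGa] Ec])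
         (use le aO \<delta>[of n] in \<open>auto simp: G_def\<close>)
    also have "\<dots> = E a * (\<delta> n powr s / s)"
      using pow[of "\<delta> n"] \<delta>[of n] by (simp add: integral_unique)
    also have "\<dots> \<le> B * (\<delta> n powr s / s)"
      using B[OF a] \<open>s > 0\<close> by (intro mult_right_mono) auto
    finally show ?thesis .
  qed
  have "(\<lambda>n. B * (\<delta> n powr s / s)) \<longlonglongrightarrow> B * (0 powr s / s)"
    unfolding \<delta>_def using \<open>s > 0\<close>
    by (intro tendsto_intros LIMSEQ_inverse_real_of_nat) auto
  then have "(\<lambda>n. B * (\<delta> n powr s / s)) \<longlonglongrightarrow> 0"
    by simp
  then have "uniform_limit (cball x d) ?F (volterra k \<phi>) sequentially"
    by (intro uniform_limitI eventually_mono[OF order_tendstoD(2)])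
       (auto simp: dist_norm intro: le_less_trans[OF diff])
  with d show "\<exists>d>0. cball x d \<subseteq> \<Omega> \<and> uniform_limit (cball x d) ?F (volterra k \<phi>) sequentially"
    by blast
qed

end

section \<open>Real estimates that make the exponential weight effective\<close>

text \<open>The inequality \<open>y \<le> exp y\<close> at \<open>y = \<mu> * x / \<gamma>\<close>,
  rearranged and raised to the power \<open>\<gamma>\<close>.\<close>

lemma powr_mult_exp_le:
  fixes x \<gamma> \<mu> :: real
  assumes "x \<ge> 0" "\<gamma> > 0" "\<mu> > 0"
  shows "x powr \<gamma> * exp (- \<mu> * x) \<le> (\<gamma> / \<mu>) powr \<gamma>"
proof -
  have "\<mu> * x / \<gamma> \<le> exp (\<mu> * x / \<gamma>)"
    using exp_ge_add_one_self[of "\<mu> * x / \<gamma>"] by linarith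
  then have "x * exp (- (\<mu> * x / \<gamma>)) \<le> \<gamma> / \<mu>"
    using assms by (simp add: exp_minus field_simps)
  then have "(x * exp (- (\<mu> * x / \<gamma>))) powr \<gamma> \<le> (\<gamma> / \<mu>) powr \<gamma>"
    using assms by (intro powr_mono2) auto
  also have "(x * exp (- (\<mu> * x / \<gamma>))) powr \<gamma> = x powr \<gamma> * exp (- \<mu> * x)"
    using assms by (simp add: powr_mult exp_powr_real)
  finally show ?thesis .
qed

text \<open>As \<open>\<mu>\<close> grows, the exponential removes all mass except at
  \<open>t = 1\<close>. Dominated convergence with majorant \<open>t powr (s - 1)\<close> gives the
  limit 0 along the integers, and monotonicity in \<open>\<mu>\<close> extends the bound to all
  larger reals.\<close>

lemma exp_powr_integral_small:
  fixes s e :: real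
  assumes "s > 0" "e > 0"
  shows "\<exists>L. \<forall>\<mu>\<ge>L. (\<lambda>t. exp (- \<mu> * (1 - t)) * t powr (s - 1)) integrable_on {0..1}
    \<and> integral {0..1} (\<lambda>t. exp (- \<mu> * (1 - t)) * t powr (s - 1)) \<le> e"
proof -
  let ?f = "\<lambda>\<mu> t. exp (- \<mu> * (1 - t)) * t powr (s - 1)"
  have pow: "(\<lambda>t. t powr (s - 1)) integrable_on {0..1}"
    using \<open>s > 0\<close> by (intro integrable_on_powr_from_0) auto
  have int: "?f \<mu> integrable_on {0..1}" if "\<mu> \<ge> 0" for \<mu>
  proof (rule integrable_continuous_dominated(1)[OF _ pow])
    show "continuous_on {0<..1} (?f \<mu>)" by (intro continuous_intros) auto
    show "norm (?f \<mu> t) \<le> t powr (s - 1)" if "0 < t" "t \<le> 1" for t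
      using that \<open>\<mu> \<ge> 0\<close> by (auto simp: abs_mult intro!: mult_left_le_one_le)
  qed
  have "(\<lambda>n. integral {0..1} (?f (real n))) \<longlonglongrightarrow> integral {0..1} (\<lambda>t :: real. if t = 1 then 1 else 0 :: real)"
  proof (rule dominated_convergence(2)[where f = "\<lambda>n. ?f (real n)", OF _ pow])
    show "?f (real n) integrable_on {0..1}" for n by (rule int) simp
  next
    fix n t assume t: "t \<in> {0..1::real}"
    then show "norm (?f (real n) t) \<le> t powr (s - 1)"
      by (auto simp: abs_mult intro!: mult_left_le_one_le)
  next
    fix t assume t: "t \<in> {0..1::real}"
    show "(\<lambda>n. ?f (real n) t) \<longlonglongrightarrow> (if t = 1 then 1 else 0)"
    proof (cases "t = 1")
      case False
      then have "1 - t > 0" using t by (auto simp: less_le)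
      then have "(\<lambda>n. exp (- real n * (1 - t))) \<longlonglongrightarrow> 0" by real_asymp
      from tendsto_mult_right[OF this, of "t powr (s - 1)"] False show ?thesis by simp
    qed simp
  qed
  \<comment> \<open>The pointwise limit is the indicator of \<open>{1}\<close>, which is zero
    outside a null set.\<close>
  also have "integral {0..1} (\<lambda>t :: real. if t = 1 then 1 else 0 :: real) = integral {0..1} (\<lambda>_::real. 0::real)"
    by (intro integral_spike[of "{1}"]) auto
  finally have "\<forall>\<^sub>F n in sequentially. integral {0..1} (?f (real n)) < e"
    using \<open>e > 0\<close> by (intro order_tendstoD(2)) auto
  then obtain n where n: "integral {0..1} (?f (real n)) < e"
    by (auto simp: eventually_sequentially)
  have "integral {0..1} (?f \<mu>) \<le> e" if "\<mu> \<ge> real n" for \<mu>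
  proof -
    have "integral {0..1} (?f \<mu>) \<le> integral {0..1} (?f (real n))"
      using that by (intro integral_le int) (auto intro!: mult_right_mono)
    with n show ?thesis by linarith
  qed
  with int show ?thesis by (intro exI[of _ "real n"]) auto
qed

section \<open>Weighted spaces\<close>

text \<open>On nonzero points this is the reciprocal of the factor in the norm of
  \<open>HLinf\<close>, so that a finite norm becomes a division-free bound by a multiple of
  \<open>weight\<close>.\<close>

definition weight :: "real \<Rightarrow> real \<Rightarrow> complex \<Rightarrow> real" where
  "weight \<sigma> \<Lambda> a = norm a powr \<sigma> * exp (\<Lambda> * norm a)"

lemma weight_nonneg [simp]: "0 \<le> weight \<sigma> \<Lambda> a"
  by (simp add: weight_def)

lemma weight_pos: "a \<noteq> 0 \<Longrightarrow> 0 < weight \<sigma> \<Lambda> a"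
  by (simp add: weight_def)

lemma weight_mono: "\<Lambda> \<le> \<Lambda>' \<Longrightarrow> weight \<sigma> \<Lambda> a \<le> weight \<sigma> \<Lambda>' a"
  by (auto simp: weight_def intro!: mult_left_mono mult_right_mono)

text \<open>The extra power \<open>norm a powr \<gamma>\<close> is absorbed by raising the
  exponential rate by 1.\<close>

lemma weight_add_le:
  assumes "\<gamma> > 0"
  shows "weight (\<sigma> + \<gamma>) \<Lambda> a \<le> \<gamma> powr \<gamma> * weight \<sigma> (\<Lambda> + 1) a"
proof -
  have "norm a powr \<gamma> \<le> \<gamma> powr \<gamma> * exp (norm a)"
    using powr_mult_exp_le[of "norm a" \<gamma> 1] assms by (simp add: exp_minus field_simps)
  then have "weight \<sigma> \<Lambda> a * norm a powr \<gamma> \<le> weight \<sigma> \<Lambda> a * (\<gamma> powr \<gamma> * exp (norm a))"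
    by (intro mult_left_mono) auto
  then show ?thesis by (simp add: weight_def powr_add exp_add algebra_simps)
qed

context punctured_star
begin

lemma HLinf_iff:
  "f \<in> HLinf \<Omega> \<sigma> \<Lambda> \<longleftrightarrow> f holomorphic_on \<Omega> \<and> (\<exists>N. \<forall>a\<in>\<Omega>. norm (f a) \<le> N * weight \<sigma> \<Lambda> a)"
proof -
  have "norm a powr (- \<sigma>) * exp (- \<Lambda> * norm a) * norm (f a) \<le> N \<longleftrightarrow> norm (f a) \<le> N * weight \<sigma> \<Lambda> a"
    if "a \<in> \<Omega>" for a N
  proof -
    have "a \<noteq> 0" using that zero_notin by auto
    then show ?thesis by (simp add: weight_def powr_minus exp_minus field_simps)
  qed
  then show ?thesis
    by (auto simp: HLinf_def bdd_above_def)
qed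

lemma HLinf_mono: "\<Lambda> \<le> \<Lambda>' \<Longrightarrow> HLinf \<Omega> \<sigma> \<Lambda> \<subseteq> HLinf \<Omega> \<sigma> \<Lambda>'"
proof
  fix f assume *: "\<Lambda> \<le> \<Lambda>'" "f \<in> HLinf \<Omega> \<sigma> \<Lambda>"
  then obtain N where N: "\<And>a. a \<in> \<Omega> \<Longrightarrow> norm (f a) \<le> N * weight \<sigma> \<Lambda> a"
    by (auto simp: HLinf_iff)
  have "norm (f a) \<le> \<bar>N\<bar> * weight \<sigma> \<Lambda>' a" if "a \<in> \<Omega>" for a
  proof -
    have "N * weight \<sigma> \<Lambda> a \<le> \<bar>N\<bar> * weight \<sigma> \<Lambda>' a"
      using weight_mono[OF *(1)] by (intro mult_mono) auto
    then show ?thesis using N[OF that] by linarith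
  qed
  then show "f \<in> HLinf \<Omega> \<sigma> \<Lambda>'" using * by (auto simp: HLinf_iff)
qed

text \<open>Membership for all large \<Lambda> lets several functions, and the threshold of the
  contraction estimate, share one common rate.\<close>

lemma HLinf_unionD:
  assumes "f \<in> HLinf_union \<Omega> \<sigma>"
  shows "\<exists>L. \<forall>\<Lambda>\<ge>L. f \<in> HLinf \<Omega> \<sigma> \<Lambda>"
  using assms HLinf_mono unfolding HLinf_union_def by blast

lemma HLinf_union_iff:
  "f \<in> HLinf_union \<Omega> \<sigma> \<longleftrightarrow> f holomorphic_on \<Omega> \<and> (\<exists>\<Lambda> N. \<forall>a\<in>\<Omega>. norm (f a) \<le> N * weight \<sigma> \<Lambda> a)"
  by (auto simp: HLinf_union_def HLinf_iff)

lemma HLinf_lin: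
  assumes "f \<in> HLinf \<Omega> \<sigma> \<Lambda>" "g \<in> HLinf \<Omega> \<sigma> \<Lambda>"
  shows "(\<lambda>a. f a + g a) \<in> HLinf \<Omega> \<sigma> \<Lambda>" "(\<lambda>a. f a - g a) \<in> HLinf \<Omega> \<sigma> \<Lambda>"
proof -
  obtain N N' where N: "\<And>a. a \<in> \<Omega> \<Longrightarrow> norm (f a) \<le> N * weight \<sigma> \<Lambda> a"
    "\<And>a. a \<in> \<Omega> \<Longrightarrow> norm (g a) \<le> N' * weight \<sigma> \<Lambda> a"
    using assms by (auto simp: HLinf_iff)
  have "norm (f a + g a) \<le> (N + N') * weight \<sigma> \<Lambda> a \<and> norm (f a - g a) \<le> (N + N') * weight \<sigma> \<Lambda> a"
    if "a \<in> \<Omega>" for a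
    using N(1)[OF that] N(2)[OF that] norm_triangle_ineq[of "f a" "g a"] norm_triangle_ineq4[of "f a" "g a"]
    unfolding distrib_right by linarith
  with assms show "(\<lambda>a. f a + g a) \<in> HLinf \<Omega> \<sigma> \<Lambda>" "(\<lambda>a. f a - g a) \<in> HLinf \<Omega> \<sigma> \<Lambda>"
    by (auto simp: HLinf_iff intro!: holomorphic_intros)
qed

lemma HLinf_union_lin:
  assumes "f \<in> HLinf_union \<Omega> \<sigma>" "g \<in> HLinf_union \<Omega> \<sigma>"
  shows "(\<lambda>a. f a + g a) \<in> HLinf_union \<Omega> \<sigma>" "(\<lambda>a. f a - g a) \<in> HLinf_union \<Omega> \<sigma>"
proof -
  obtain L where L: "\<forall>\<Lambda>\<ge>L. f \<in> HLinf \<Omega> \<sigma> \<Lambda>" using HLinf_unionD[OF assms(1)] by blast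
  obtain L' where "\<forall>\<Lambda>\<ge>L'. g \<in> HLinf \<Omega> \<sigma> \<Lambda>" using HLinf_unionD[OF assms(2)] by blast
  with L have "f \<in> HLinf \<Omega> \<sigma> (max L L')" "g \<in> HLinf \<Omega> \<sigma> (max L L')" by auto
  from HLinf_lin[OF this] show "(\<lambda>a. f a + g a) \<in> HLinf_union \<Omega> \<sigma>" "(\<lambda>a. f a - g a) \<in> HLinf_union \<Omega> \<sigma>"
    by (auto simp: HLinf_union_def)
qed

lemma HLinf_union_add_subset:
  assumes "\<gamma> > 0"
  shows "HLinf_union \<Omega> (\<sigma> + \<gamma>) \<subseteq> HLinf_union \<Omega> \<sigma>"
proof
  fix f assume f: "f \<in> HLinf_union \<Omega> (\<sigma> + \<gamma>)"
  then obtain \<Lambda> N where N: "\<And>a. a \<in> \<Omega> \<Longrightarrow> norm (f a) \<le> N * weight (\<sigma> + \<gamma>) \<Lambda> a"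
    by (auto simp: HLinf_union_iff)
  have "norm (f a) \<le> (\<bar>N\<bar> * \<gamma> powr \<gamma>) * weight \<sigma> (\<Lambda> + 1) a" if "a \<in> \<Omega>" for a
  proof -
    have "N * weight (\<sigma> + \<gamma>) \<Lambda> a \<le> \<bar>N\<bar> * (\<gamma> powr \<gamma> * weight \<sigma> (\<Lambda> + 1) a)"
      using weight_add_le[OF assms] by (intro mult_mono) auto
    then show ?thesis using N[OF that] by (simp add: mult.assoc)
  qed
  with f show "f \<in> HLinf_union \<Omega> \<sigma>" unfolding HLinf_union_iff by blast
qed

section \<open>Volterra operators in weighted norms\<close>

text \<open>The weight at \<open>t * a\<close> equals the weight at \<open>a\<close> times
  \<open>t powr \<sigma> * exp (- \<Lambda> * ((1 - t) * norm a))\<close>. Attaching the exponential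
  to the kernel leaves one quantity \<open>g\<close> to be estimated for each kernel.\<close>

lemma ray_integrand_weighted:
  assumes \<phi>: "\<And>a. a \<in> \<Omega> \<Longrightarrow> norm (\<phi> a) \<le> N * weight \<sigma> \<Lambda> a"
    and a: "a \<in> \<Omega>" and t: "0 < t" "t \<le> 1"
    and k: "norm (k a (of_real t * a)) * norm a * exp (- \<Lambda> * ((1 - t) * norm a)) \<le> g"
  shows "norm (k a (of_real t * a) * \<phi> (of_real t * a) * a) \<le> N * weight \<sigma> \<Lambda> a * (g * t powr \<sigma>)"
proof -
  \<comment> \<open>The sign of \<open>N\<close> is read off from the assumed bound at
    \<open>a\<close>, where the weight is strictly positive.\<close>
  have "0 < weight \<sigma> \<Lambda> a" using a zero_notin by (intro weight_pos) auto
  moreover have "0 \<le> N * weight \<sigma> \<Lambda> a" using order_trans[OF norm_ge_zero \<phi>[OF a]] .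
  ultimately have N: "N \<ge> 0" by (simp add: zero_le_mult_iff)
  have "norm (k a (of_real t * a) * \<phi> (of_real t * a) * a)
      \<le> norm (k a (of_real t * a)) * (N * weight \<sigma> \<Lambda> (of_real t * a)) * norm a"
    unfolding norm_mult by (intro mult_right_mono mult_left_mono \<phi> ray a t) auto
  also have "\<dots> = N * weight \<sigma> \<Lambda> a * ((norm (k a (of_real t * a)) * norm a * exp (- \<Lambda> * ((1 - t) * norm a))) * t powr \<sigma>)"
    using t by (simp add: weight_def norm_mult powr_mult algebra_simps flip: exp_add)
  also have "\<dots> \<le> N * weight \<sigma> \<Lambda> a * (g * t powr \<sigma>)"
    using k N by (intro mult_left_mono mult_right_mono) auto
  finally show ?thesis .
qed

lemma volterra_weighted:
  assumes k: "(\<lambda>(a, a'). k a a') holomorphic2_on \<Omega> \<times> \<Omega>" and \<phi>: "\<phi> holomorphic_on \<Omega>"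
    and le: "\<And>a. a \<in> \<Omega> \<Longrightarrow> norm (\<phi> a) \<le> N * weight \<sigma> \<Lambda> a"
    and a: "a \<in> \<Omega>" and g: "(\<lambda>t. g t * t powr \<sigma>) integrable_on {0..1}"
    and kg: "\<And>t. 0 < t \<Longrightarrow> t \<le> 1 \<Longrightarrow>
      norm (k a (of_real t * a)) * norm a * exp (- \<Lambda> * ((1 - t) * norm a)) \<le> g t"
  shows "(\<lambda>a'. k a a' * \<phi> a') contour_integrable_on linepath 0 a"
    and "norm (volterra k \<phi> a) \<le> N * weight \<sigma> \<Lambda> a * integral {0..1} (\<lambda>t. g t * t powr \<sigma>)"
  using volterra_dominated[OF k \<phi> a integrable_on_mult_right[OF g, of "N * weight \<sigma> \<Lambda> a"]]
    ray_integrand_weighted[of \<phi> N \<sigma> \<Lambda> a _ k, OF le a _ _ kg]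
  by auto

text \<open>A constant bound \<open>g\<close> contributes \<open>g / s\<close>, because
  \<open>t powr (s - 1)\<close> has integral \<open>1 / s\<close> over the unit interval. Writing
  the exponent as \<open>s - 1\<close> turns convergence at 0 into \<open>s > 0\<close>.\<close>

lemma volterra_weighted_const:
  assumes k: "(\<lambda>(a, a'). k a a') holomorphic2_on \<Omega> \<times> \<Omega>" and \<phi>: "\<phi> holomorphic_on \<Omega>"
    and le: "\<And>a. a \<in> \<Omega> \<Longrightarrow> norm (\<phi> a) \<le> N * weight (s - 1) \<Lambda> a"
    and a: "a \<in> \<Omega>" and s: "s > 0"
    and kg: "\<And>t. 0 < t \<Longrightarrow> t \<le> 1 \<Longrightarrow>
      norm (k a (of_real t * a)) * norm a * exp (- \<Lambda> * ((1 - t) * norm a)) \<le> g"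
  shows "(\<lambda>a'. k a a' * \<phi> a') contour_integrable_on linepath 0 a"
    and "norm (volterra k \<phi> a) \<le> g / s * N * weight (s - 1) \<Lambda> a"
proof -
  have "((\<lambda>t. g * t powr (s - 1)) has_integral (g * (1 / s))) {0..1}"
    using has_integral_powr_from_0[of "s - 1" 1] s by (intro has_integral_mult_right) simp
  then have "(\<lambda>t. g * t powr (s - 1)) integrable_on {0..1}"
    "integral {0..1} (\<lambda>t. g * t powr (s - 1)) = g / s"
    by (auto simp del: integral_mult_right dest: integral_unique)
  note * = this volterra_weighted[OF k \<phi> le a this(1) kg]
  show "(\<lambda>a'. k a a' * \<phi> a') contour_integrable_on linepath 0 a" by (rule *(3))
  have "norm (volterra k \<phi> a) \<le> N * weight (s - 1) \<Lambda> a * (g / s)"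
    using *(4) unfolding *(2) .
  then show "norm (volterra k \<phi> a) \<le> g / s * N * weight (s - 1) \<Lambda> a" by (simp add: mult_ac)
qed

text \<open>Here \<open>g\<close> may vary with \<open>a\<close>. The majorant stays continuous on
  \<open>\<Omega>\<close> because the weight can be singular only at the excluded point 0.\<close>

lemma volterra_holomorphic_weighted:
  assumes k: "(\<lambda>(a, a'). k a a') holomorphic2_on \<Omega> \<times> \<Omega>" and \<phi>: "\<phi> holomorphic_on \<Omega>"
    and le: "\<And>a. a \<in> \<Omega> \<Longrightarrow> norm (\<phi> a) \<le> N * weight (s - 1) \<Lambda> a"
    and s: "s > 0" and g: "continuous_on \<Omega> g"
    and kg: "\<And>a t. a \<in> \<Omega> \<Longrightarrow> 0 < t \<Longrightarrow> t \<le> 1 \<Longrightarrow>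
      norm (k a (of_real t * a)) * norm a * exp (- \<Lambda> * ((1 - t) * norm a)) \<le> g a"
  shows "volterra k \<phi> holomorphic_on \<Omega>"
proof (rule volterra_holomorphic[OF k \<phi> _ s])
  show "continuous_on \<Omega> (\<lambda>a. N * weight (s - 1) \<Lambda> a * g a)"
    unfolding weight_def using zero_notin by (intro continuous_intros g) auto
qed (use ray_integrand_weighted[of \<phi> N "s - 1" \<Lambda> _ _ k, OF le _ _ _ kg] in \<open>simp add: mult.assoc\<close>)

end

section \<open>Contraction and the Neumann series\<close>

locale volterra_pair = punctured_star +
  fixes k0 ks :: "complex \<Rightarrow> complex \<Rightarrow> complex" and \<tau> \<gamma> \<nu> M :: real
  assumes nonempty: "\<Omega> \<noteq> {}"
    and k0: "(\<lambda>(a, a'). k0 a a') holomorphic2_on \<Omega> \<times> \<Omega>"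
    and ks: "(\<lambda>(a, a'). ks a a') holomorphic2_on \<Omega> \<times> \<Omega>"
    and \<tau>: "\<tau> > 0" and \<gamma>: "\<gamma> > 0"
    and k0_near: "\<And>\<sigma>::real. \<sigma> > \<tau> \<Longrightarrow>
           \<exists>U. open U \<and> (0, 0) \<in> U \<and> (\<forall>(a, a') \<in> U \<inter> \<Omega> \<times> \<Omega>. norm (k0 a a') < \<sigma> / norm a)"
    and k0_bound: "\<And>a a'. a \<in> \<Omega> \<Longrightarrow> a' \<in> \<Omega> \<Longrightarrow> norm (k0 a a') \<le> M / norm a * exp (\<nu> * norm (a - a'))"
    and ks_bound: "\<And>a a'. a \<in> \<Omega> \<Longrightarrow> a' \<in> \<Omega> \<Longrightarrow>
           norm (ks a a') \<le> M * (norm (a - a') powr \<gamma> / norm a) * exp (\<nu> * norm (a - a'))"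
begin

section \<open>Kernel bounds along rays\<close>

lemma M_nonneg: "M \<ge> 0"
proof -
  obtain a where a: "a \<in> \<Omega>" using nonempty by auto
  then have "a \<noteq> 0" using zero_notin by auto
  moreover have "0 \<le> M / norm a" using k0_bound[OF a a] order_trans[OF norm_ge_zero] by fastforce
  ultimately show ?thesis by (simp add: zero_le_divide_iff)
qed

lemma dist_ray: "t \<le> 1 \<Longrightarrow> norm (a - of_real t * a) = (1 - t) * norm a" for a :: complex
proof -
  assume "t \<le> 1"
  have "a - of_real t * a = of_real (1 - t) * a" by (simp add: algebra_simps)
  then show ?thesis using \<open>t \<le> 1\<close> by (simp only: norm_mult norm_of_real)
qed

text \<open>Along a ray \<open>norm (a - t * a) = (1 - t) * norm a\<close>, so the growth rate
  \<open>\<nu>\<close> of the kernel and the decay rate \<Lambda> from the weight merge into the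
  single rate \<open>\<Lambda> - \<nu>\<close>.\<close>

lemma k0_ray:
  assumes a: "a \<in> \<Omega>" and t: "0 < t" "t \<le> 1"
  shows "norm (k0 a (of_real t * a)) * norm a * exp (- \<Lambda> * ((1 - t) * norm a))
    \<le> M * exp (- (\<Lambda> - \<nu>) * ((1 - t) * norm a))"
proof -
  have "a \<noteq> 0" using a zero_notin by auto
  have "norm (k0 a (of_real t * a)) * norm a \<le> M / norm a * exp (\<nu> * ((1 - t) * norm a)) * norm a"
    using k0_bound[OF a ray[OF a t]] unfolding dist_ray[OF t(2)] by (rule mult_right_mono) simp
  then have "norm (k0 a (of_real t * a)) * norm a \<le> M * exp (\<nu> * ((1 - t) * norm a))"
    using \<open>a \<noteq> 0\<close> by simp
  then have "norm (k0 a (of_real t * a)) * norm a * exp (- \<Lambda> * ((1 - t) * norm a))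
      \<le> M * exp (\<nu> * ((1 - t) * norm a)) * exp (- \<Lambda> * ((1 - t) * norm a))"
    by (rule mult_right_mono) simp
  then show ?thesis by (simp add: mult.assoc left_diff_distrib flip: exp_add)
qed

text \<open>The same merging of rates. The surviving power of \<open>(1 - t) * norm a\<close> is
  used in two ways: it improves the exponent by \<open>\<gamma>\<close>, and against the exponential
  it is small for large \<Lambda>.\<close>

lemma ks_ray:
  assumes a: "a \<in> \<Omega>" and t: "0 < t" "t \<le> 1"
  shows "norm (ks a (of_real t * a)) * norm a * exp (- \<Lambda> * ((1 - t) * norm a))
    \<le> M * (((1 - t) * norm a) powr \<gamma> * exp (- (\<Lambda> - \<nu>) * ((1 - t) * norm a)))"
proof -
  have "a \<noteq> 0" using a zero_notin by auto
  have "norm (ks a (of_real t * a)) * norm a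
      \<le> M * (((1 - t) * norm a) powr \<gamma> / norm a) * exp (\<nu> * ((1 - t) * norm a)) * norm a"
    using ks_bound[OF a ray[OF a t]] unfolding dist_ray[OF t(2)] by (rule mult_right_mono) simp
  then have "norm (ks a (of_real t * a)) * norm a
      \<le> M * ((1 - t) * norm a) powr \<gamma> * exp (\<nu> * ((1 - t) * norm a))"
    using \<open>a \<noteq> 0\<close> by (simp add: mult_ac)
  then have "norm (ks a (of_real t * a)) * norm a * exp (- \<Lambda> * ((1 - t) * norm a))
      \<le> M * ((1 - t) * norm a) powr \<gamma> * exp (\<nu> * ((1 - t) * norm a)) * exp (- \<Lambda> * ((1 - t) * norm a))"
    by (rule mult_right_mono) simp
  then show ?thesis by (simp add: mult.assoc left_diff_distrib flip: exp_add)
qed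

lemma k0_ray_le:
  assumes "a \<in> \<Omega>" "0 < t" "t \<le> 1" "\<Lambda> \<ge> \<nu>"
  shows "norm (k0 a (of_real t * a)) * norm a * exp (- \<Lambda> * ((1 - t) * norm a)) \<le> M"
proof -
  have "exp (- (\<Lambda> - \<nu>) * ((1 - t) * norm a)) \<le> 1"
    using assms by (simp add: mult_nonpos_nonneg)
  then have "M * exp (- (\<Lambda> - \<nu>) * ((1 - t) * norm a)) \<le> M"
    using M_nonneg by (intro mult_left_le) auto
  then show ?thesis using k0_ray[OF assms(1-3), of \<Lambda>] by linarith
qed

lemma ks_ray_le:
  assumes "a \<in> \<Omega>" "0 < t" "t \<le> 1" "\<Lambda> \<ge> \<nu>"
  shows "norm (ks a (of_real t * a)) * norm a * exp (- \<Lambda> * ((1 - t) * norm a)) \<le> M * norm a powr \<gamma>"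
proof -
  have "((1 - t) * norm a) powr \<gamma> * exp (- (\<Lambda> - \<nu>) * ((1 - t) * norm a)) \<le> norm a powr \<gamma> * 1"
    using assms \<gamma> by (intro mult_mono powr_mono2 mult_left_le_one_le) (auto simp: mult_nonpos_nonneg)
  then have "M * (((1 - t) * norm a) powr \<gamma> * exp (- (\<Lambda> - \<nu>) * ((1 - t) * norm a))) \<le> M * (norm a powr \<gamma> * 1)"
    using M_nonneg by (rule mult_left_mono)
  then show ?thesis using ks_ray[OF assms(1-3), of \<Lambda>] by linarith
qed

definition V :: "(complex \<Rightarrow> complex) \<Rightarrow> complex \<Rightarrow> complex" where
  "V \<phi> a = volterra k0 \<phi> a + volterra ks \<phi> a"

text \<open>Once the rate is at least \<open>\<nu>\<close>, the exponentials along the ray are at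
  most 1, so both integrands have integrable majorants. For \<open>ks\<close> the factor
  \<open>norm a powr \<gamma>\<close> comes out of the integral and becomes the gain in the
  exponent.\<close>

lemma HLinf_regular:
  assumes "\<phi> \<in> HLinf_union \<Omega> (s - 1)" and "s > 0"
  shows "volterra k0 \<phi> holomorphic_on \<Omega>" and "volterra ks \<phi> \<in> HLinf_union \<Omega> (s - 1 + \<gamma>)"
    and "\<And>a. a \<in> \<Omega> \<Longrightarrow> (\<lambda>a'. k0 a a' * \<phi> a') contour_integrable_on linepath 0 a"
    and "\<And>a. a \<in> \<Omega> \<Longrightarrow> (\<lambda>a'. ks a a' * \<phi> a') contour_integrable_on linepath 0 a"
proof -
  obtain L where "\<forall>\<Lambda>\<ge>L. \<phi> \<in> HLinf \<Omega> (s - 1) \<Lambda>"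
    using HLinf_unionD[OF assms(1)] by blast
  then obtain \<Lambda> where \<Lambda>: "\<phi> \<in> HLinf \<Omega> (s - 1) \<Lambda>" "\<Lambda> \<ge> \<nu>"
    by (meson max.cobounded1 max.cobounded2)
  then obtain N where \<phi>: "\<phi> holomorphic_on \<Omega>" and N: "\<And>a. a \<in> \<Omega> \<Longrightarrow> norm (\<phi> a) \<le> N * weight (s - 1) \<Lambda> a"
    by (auto simp: HLinf_iff)
  note ks_const = volterra_weighted_const[OF ks \<phi> N _ \<open>s > 0\<close> ks_ray_le[OF _ _ _ \<Lambda>(2)]]
  show "volterra k0 \<phi> holomorphic_on \<Omega>"
    by (rule volterra_holomorphic_weighted[OF k0 \<phi> N \<open>s > 0\<close> _ k0_ray_le]) (auto simp: \<Lambda>)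
  show "(\<lambda>a'. k0 a a' * \<phi> a') contour_integrable_on linepath 0 a" if "a \<in> \<Omega>" for a
    using volterra_weighted_const(1)[OF k0 \<phi> N that \<open>s > 0\<close> k0_ray_le[OF that _ _ \<Lambda>(2)]] .
  show "(\<lambda>a'. ks a a' * \<phi> a') contour_integrable_on linepath 0 a" if "a \<in> \<Omega>" for a
    using ks_const(1) that by blast
  have "volterra ks \<phi> holomorphic_on \<Omega>"
    by (rule volterra_holomorphic_weighted[OF ks \<phi> N \<open>s > 0\<close> _ ks_ray_le])
       (use \<Lambda> zero_notin in \<open>auto intro!: continuous_intros\<close>)
  moreover have "norm (volterra ks \<phi> a) \<le> (M * N / s) * weight (s - 1 + \<gamma>) \<Lambda> a" if "a \<in> \<Omega>" for a
    using ks_const(2)[OF _ that that] by (simp add: weight_def powr_add mult_ac)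
  ultimately show "volterra ks \<phi> \<in> HLinf_union \<Omega> (s - 1 + \<gamma>)"
    unfolding HLinf_union_iff by blast
qed

lemma V_lin:
  assumes "s > 0" "f \<in> HLinf_union \<Omega> (s - 1)" "g \<in> HLinf_union \<Omega> (s - 1)" "a \<in> \<Omega>"
  shows "V (\<lambda>x. f x + g x) a = V f a + V g a" "V (\<lambda>x. f x - g x) a = V f a - V g a"
  using HLinf_regular(3,4)[OF assms(2,1,4)] HLinf_regular(3,4)[OF assms(3,1,4)]
  by (simp_all add: V_def volterra_def right_diff_distrib distrib_left contour_integral_diff contour_integral_add)

text \<open>The part with \<open>k0\<close> costs at most \<open>\<sigma> / s < 1\<close>, and the
  part with \<open>ks\<close> at most half of the remaining gap \<open>1 - \<sigma> / s\<close>.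
  Neither \<open>\<kappa>\<close> nor \<open>L\<close> depends on \<open>\<phi>\<close> or
  \<open>N\<close>, so the estimate can be iterated at a fixed rate.\<close>

lemma V_contraction:
  assumes "s > \<tau>"
  obtains \<kappa> L where "0 \<le> \<kappa>" "\<kappa> < 1"
    and "\<And>\<Lambda> N \<phi> a. \<Lambda> \<ge> L \<Longrightarrow> \<phi> holomorphic_on \<Omega> \<Longrightarrow>
      (\<And>x. x \<in> \<Omega> \<Longrightarrow> norm (\<phi> x) \<le> N * weight (s - 1) \<Lambda> x) \<Longrightarrow> a \<in> \<Omega> \<Longrightarrow>
      norm (V \<phi> a) \<le> \<kappa> * N * weight (s - 1) \<Lambda> a"
proof -
  have s: "s > 0" using assms \<tau> by linarith
  \<comment> \<open>The midpoint of \<open>\<tau>\<close> and \<open>s\<close> leaves room on both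
    sides: above \<open>\<tau>\<close> for the kernel bound near the origin, below \<open>s\<close>
    for a factor less than 1.\<close>
  define \<sigma> where "\<sigma> = (\<tau> + s) / 2"
  have \<sigma>: "\<tau> < \<sigma>" "\<sigma> < s" "\<sigma> > 0" using assms \<tau> by (auto simp: \<sigma>_def)
  define \<kappa> where "\<kappa> = (1 + \<sigma> / s) / 2"
  have \<sigma>s: "0 < \<sigma> / s" "\<sigma> / s < 1" using \<sigma> s by auto
  obtain U where "open U" "(0, 0) \<in> U" and U: "\<forall>(a, a') \<in> U \<inter> \<Omega> \<times> \<Omega>. norm (k0 a a') < \<sigma> / norm a"
    using k0_near[OF \<sigma>(1)] by auto
  then obtain A B where AB: "open A" "open B" "0 \<in> A" "0 \<in> B" "A \<times> B \<subseteq> U"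
    using open_prod_elim[of U "(0, 0)"] by (metis mem_Sigma_iff)
  then obtain \<epsilon> where \<epsilon>: "\<epsilon> > 0" "ball 0 \<epsilon> \<subseteq> A \<inter> B"
    by (meson IntI open_Int open_contains_ball)
  have near: "norm (k0 a a') < \<sigma> / norm a" if "a \<in> \<Omega>" "a' \<in> \<Omega>" "norm a < \<epsilon>" "norm a' < \<epsilon>" for a a'
  proof -
    have "a \<in> ball 0 \<epsilon>" "a' \<in> ball 0 \<epsilon>" using that by auto
    then have "(a, a') \<in> U" using AB(5) \<epsilon>(2) by blast
    with U that show ?thesis by blast
  qed
  \<comment> \<open>Dividing by \<open>M + 1\<close> covers \<open>M = 0\<close> as well; the later
    factor \<open>M\<close> gives \<open>M / (M + 1) \<le> 1\<close>, hence a total of at most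
    \<open>\<sigma> / s\<close>.\<close>
  have "\<sigma> / s / (M + 1) > 0" using \<sigma> s M_nonneg by auto
  then obtain L1 where L1: "\<And>\<mu>. \<mu> \<ge> L1 \<Longrightarrow> (\<lambda>t. exp (- \<mu> * (1 - t)) * t powr (s - 1)) integrable_on {0..1}"
      "\<And>\<mu>. \<mu> \<ge> L1 \<Longrightarrow> integral {0..1} (\<lambda>t. exp (- \<mu> * (1 - t)) * t powr (s - 1)) \<le> \<sigma> / s / (M + 1)"
    using exp_powr_integral_small[OF s] by blast
  have "((\<lambda>\<mu>. M * (\<gamma> / \<mu>) powr \<gamma> / s) \<longlongrightarrow> M * 0 powr \<gamma> / s) at_top"
    using \<gamma> s
    by (intro tendsto_intros tendsto_divide_0[OF tendsto_const] filterlim_at_top_imp_at_infinity filterlim_ident)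
       (auto intro: eventually_mono[OF eventually_gt_at_top[of 0]])
  then have "\<forall>\<^sub>F \<mu> in at_top. M * (\<gamma> / \<mu>) powr \<gamma> / s < (1 - \<sigma> / s) / 2"
    by (rule order_tendstoD) (use \<sigma>s in auto)
  then obtain L2 where L2: "\<And>\<mu>. \<mu> \<ge> L2 \<Longrightarrow> M * (\<gamma> / \<mu>) powr \<gamma> / s < (1 - \<sigma> / s) / 2"
    by (auto simp: eventually_at_top_linorder)
  \<comment> \<open>The four entries ensure in turn that \<Lambda> is nonnegative, that
    \<open>\<Lambda> - \<nu>\<close> is positive, that
    \<open>(\<Lambda> - \<nu>) * \<epsilon>\<close> exceeds \<open>L1\<close>, and that the bound
    for \<open>ks\<close> is small.\<close>
  define L where "L = Max {0, \<nu> + 1, \<nu> + L1 / \<epsilon>, \<nu> + L2}"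
  have "norm (V \<phi> a) \<le> \<kappa> * N * weight (s - 1) \<Lambda> a"
    if \<Lambda>: "\<Lambda> \<ge> L" and \<phi>: "\<phi> holomorphic_on \<Omega>"
      and N: "\<And>x. x \<in> \<Omega> \<Longrightarrow> norm (\<phi> x) \<le> N * weight (s - 1) \<Lambda> x" and a: "a \<in> \<Omega>" for \<Lambda> N \<phi> a
  proof -
    have \<Lambda>': "\<Lambda> \<ge> 0" "\<Lambda> \<ge> \<nu> + 1" "\<Lambda> - \<nu> \<ge> L1 / \<epsilon>" "\<Lambda> - \<nu> \<ge> L2"
      using \<Lambda> by (auto simp: L_def)
    let ?W = "N * weight (s - 1) \<Lambda> a"
    have W: "0 \<le> ?W" using order_trans[OF norm_ge_zero N[OF a]] .
    have V0: "norm (volterra k0 \<phi> a) \<le> \<sigma> / s * ?W"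
    \<comment> \<open>Near 0 the whole ray lies in the ball where
      \<open>norm (k0 a a') < \<sigma> / norm a\<close>. Away from 0 the cruder constant
      \<open>M\<close> is compensated by exponential decay.\<close>
    proof (cases "norm a < \<epsilon>")
      case True
      have "norm (k0 a (of_real t * a)) * norm a * exp (- \<Lambda> * ((1 - t) * norm a)) \<le> \<sigma>"
        if t: "0 < t" "t \<le> 1" for t
      proof -
        have "a \<noteq> 0" using a zero_notin by auto
        have "norm (of_real t * a) \<le> norm a"
          using t by (simp add: norm_mult mult_left_le_one_le)
        then have "norm (k0 a (of_real t * a)) < \<sigma> / norm a"
          using True by (intro near a ray t) auto
        then have *: "norm (k0 a (of_real t * a)) * norm a \<le> \<sigma>"
          using \<open>a \<noteq> 0\<close> by (simp add: field_simps)
        have "exp (- \<Lambda> * ((1 - t) * norm a)) \<le> 1"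
          using \<Lambda>' t by simp
        then have "norm (k0 a (of_real t * a)) * norm a * exp (- \<Lambda> * ((1 - t) * norm a))
            \<le> norm (k0 a (of_real t * a)) * norm a"
          by (intro mult_left_le) auto
        with * show ?thesis by linarith
      qed
      from volterra_weighted_const(2)[OF k0 \<phi> N a s this] show ?thesis
        by (simp add: mult.assoc)
    next
      case False
      \<comment> \<open>Since \<open>norm a \<ge> \<epsilon>\<close> in this case, the decay rate in
        \<open>1 - t\<close> is at least this value, uniformly in \<open>a\<close>.\<close>
      let ?\<mu> = "(\<Lambda> - \<nu>) * \<epsilon>"
      have \<mu>: "?\<mu> \<ge> L1" using \<Lambda>' \<epsilon> by (simp add: field_simps)
      have bd: "norm (k0 a (of_real t * a)) * norm a * exp (- \<Lambda> * ((1 - t) * norm a))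
          \<le> M * exp (- ?\<mu> * (1 - t))" if t: "0 < t" "t \<le> 1" for t
      proof -
        have "(\<Lambda> - \<nu>) * ((1 - t) * \<epsilon>) \<le> (\<Lambda> - \<nu>) * ((1 - t) * norm a)"
          using False \<Lambda>' t by (intro mult_left_mono) auto
        then have "M * exp (- (\<Lambda> - \<nu>) * ((1 - t) * norm a)) \<le> M * exp (- ?\<mu> * (1 - t))"
          using M_nonneg by (intro mult_left_mono) (auto simp: algebra_simps)
        then show ?thesis using k0_ray[OF a t, of \<Lambda>] by linarith
      qed
      have int: "(\<lambda>t. M * exp (- ?\<mu> * (1 - t)) * t powr (s - 1)) integrable_on {0..1}"
        using integrable_on_mult_right[OF L1(1)[OF \<mu>], of M] by (simp add: mult.assoc)
      have "norm (volterra k0 \<phi> a) \<le> ?W * integral {0..1} (\<lambda>t. M * exp (- ?\<mu> * (1 - t)) * t powr (s - 1))"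
        by (rule volterra_weighted(2)[OF k0 \<phi> N a int bd])
      also have "\<dots> = ?W * (M * integral {0..1} (\<lambda>t. exp (- ?\<mu> * (1 - t)) * t powr (s - 1)))"
        by (simp add: mult.assoc)
      also have "\<dots> \<le> ?W * (\<sigma> / s)"
      proof (rule mult_left_mono[OF _ W])
        have "M * integral {0..1} (\<lambda>t. exp (- ?\<mu> * (1 - t)) * t powr (s - 1)) \<le> M * (\<sigma> / s / (M + 1))"
          using L1(2)[OF \<mu>] M_nonneg by (intro mult_left_mono)
        also have "\<dots> = (M / (M + 1)) * (\<sigma> / s)" by simp
        also have "\<dots> \<le> 1 * (\<sigma> / s)"
          using M_nonneg \<sigma>s by (intro mult_right_mono) (auto simp: divide_simps)
        finally show "M * integral {0..1} (\<lambda>t. exp (- ?\<mu> * (1 - t)) * t powr (s - 1)) \<le> \<sigma> / s" by simp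
      qed
      finally show ?thesis by (simp add: mult_ac)
    qed
    have bd: "norm (ks a (of_real t * a)) * norm a * exp (- \<Lambda> * ((1 - t) * norm a))
        \<le> M * (\<gamma> / (\<Lambda> - \<nu>)) powr \<gamma>" if t: "0 < t" "t \<le> 1" for t
    proof -
      have "M * (((1 - t) * norm a) powr \<gamma> * exp (- (\<Lambda> - \<nu>) * ((1 - t) * norm a)))
          \<le> M * (\<gamma> / (\<Lambda> - \<nu>)) powr \<gamma>"
        using \<Lambda>' t \<gamma> M_nonneg by (intro mult_left_mono powr_mult_exp_le) auto
      then show ?thesis using ks_ray[OF a t, of \<Lambda>] by linarith
    qed
    have "norm (volterra ks \<phi> a) \<le> M * (\<gamma> / (\<Lambda> - \<nu>)) powr \<gamma> / s * ?W"
      using volterra_weighted_const(2)[OF ks \<phi> N a s bd] by (simp add: mult.assoc)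
    also have "\<dots> \<le> (1 - \<sigma> / s) / 2 * ?W"
      using L2[OF \<Lambda>'(4)] W by (intro mult_right_mono) auto
    finally have "norm (V \<phi> a) \<le> \<sigma> / s * ?W + (1 - \<sigma> / s) / 2 * ?W"
      using V0 norm_triangle_ineq[of "volterra k0 \<phi> a" "volterra ks \<phi> a"] unfolding V_def by linarith
    also have "\<dots> = \<kappa> * N * weight (s - 1) \<Lambda> a"
      by (simp add: \<kappa>_def field_simps)
    finally show ?thesis .
  qed
  moreover have "0 \<le> \<kappa>" "\<kappa> < 1" using \<sigma>s by (auto simp: \<kappa>_def)
  ultimately show thesis using that by blast
qed

section \<open>Fixed points of the contraction\<close>

text \<open>Iterating \<open>d = V d\<close> multiplies the weighted bound by
  \<open>\<kappa>\<close> each time, so it tends to 0 pointwise.\<close>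

lemma V_unique:
  assumes "s > \<tau>" and d: "d \<in> HLinf_union \<Omega> (s - 1)" and eq: "\<And>a. a \<in> \<Omega> \<Longrightarrow> d a = V d a"
    and a: "a \<in> \<Omega>"
  shows "d a = 0"
proof -
  obtain \<kappa> L where \<kappa>: "0 \<le> \<kappa>" "\<kappa> < 1"
    and contr: "\<And>\<Lambda> N \<phi> a. \<Lambda> \<ge> L \<Longrightarrow> \<phi> holomorphic_on \<Omega> \<Longrightarrow>
      (\<And>x. x \<in> \<Omega> \<Longrightarrow> norm (\<phi> x) \<le> N * weight (s - 1) \<Lambda> x) \<Longrightarrow> a \<in> \<Omega> \<Longrightarrow>
      norm (V \<phi> a) \<le> \<kappa> * N * weight (s - 1) \<Lambda> a"
    using V_contraction[OF assms(1)] by blast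
  obtain L' where "\<forall>\<Lambda>\<ge>L'. d \<in> HLinf \<Omega> (s - 1) \<Lambda>" using HLinf_unionD[OF d] by blast
  then have "d \<in> HLinf \<Omega> (s - 1) (max L L')" by simp
  then obtain N where hol: "d holomorphic_on \<Omega>"
    and N: "\<And>x. x \<in> \<Omega> \<Longrightarrow> norm (d x) \<le> N * weight (s - 1) (max L L') x"
    by (auto simp: HLinf_iff)
  have "norm (d x) \<le> \<kappa> ^ n * N * weight (s - 1) (max L L') x" if "x \<in> \<Omega>" for n x
    using that
  proof (induction n arbitrary: x)
    case (Suc n)
    with contr[OF _ hol Suc.IH, of x] eq[of x] show ?case by (simp add: mult_ac)
  qed (use N in simp)
  moreover have "(\<lambda>n. \<kappa> ^ n * N * weight (s - 1) (max L L') a) \<longlonglongrightarrow> 0 * N * weight (s - 1) (max L L') a"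
    using \<kappa> by (intro tendsto_intros LIMSEQ_power_zero) auto
  ultimately have "norm (d a) \<le> 0"
    using a by (intro LIMSEQ_le_const) auto
  then show ?thesis by simp
qed

text \<open>The solution is the Neumann series of iterates of \<open>V\<close> on \<open>w\<close>.
  Its limit equation follows from \<open>S (Suc n) = w + V (S n)\<close> on \<open>\<Omega>\<close>
  and the contraction estimate for \<open>h - S n\<close>, with no interchange of \<open>V\<close>
  and the infinite sum.\<close>

lemma V_resolvent:
  assumes "s > \<tau>" and w: "w \<in> HLinf_union \<Omega> (s - 1)"
  obtains h where "h \<in> HLinf_union \<Omega> (s - 1)" "\<And>a. a \<in> \<Omega> \<Longrightarrow> h a = w a + V h a"
proof -
  have s: "s > 0" using assms(1) \<tau> by linarith
  obtain \<kappa> L where \<kappa>: "0 \<le> \<kappa>" "\<kappa> < 1"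
    and contr: "\<And>\<Lambda> N \<phi> a. \<Lambda> \<ge> L \<Longrightarrow> \<phi> holomorphic_on \<Omega> \<Longrightarrow>
      (\<And>x. x \<in> \<Omega> \<Longrightarrow> norm (\<phi> x) \<le> N * weight (s - 1) \<Lambda> x) \<Longrightarrow> a \<in> \<Omega> \<Longrightarrow>
      norm (V \<phi> a) \<le> \<kappa> * N * weight (s - 1) \<Lambda> a"
    using V_contraction[OF assms(1)] by blast
  obtain L' where L': "\<forall>\<Lambda>\<ge>L'. w \<in> HLinf \<Omega> (s - 1) \<Lambda>" using HLinf_unionD[OF w] by blast
  define \<Lambda> where "\<Lambda> = max L L'"
  have \<Lambda>: "\<Lambda> \<ge> L" "w \<in> HLinf \<Omega> (s - 1) \<Lambda>" using L' by (auto simp: \<Lambda>_def)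
  let ?W = "weight (s - 1) \<Lambda>"
  obtain N where w_hol: "w holomorphic_on \<Omega>" and N: "\<And>x. x \<in> \<Omega> \<Longrightarrow> norm (w x) \<le> N * ?W x"
    using \<Lambda>(2) by (auto simp: HLinf_iff)
  define u where "u n = (V ^^ n) w" for n
  have u: "u n holomorphic_on \<Omega> \<and> (\<forall>x\<in>\<Omega>. norm (u n x) \<le> \<kappa> ^ n * N * ?W x)" for n
  proof (induction n)
    case (Suc n)
    then have "u n \<in> HLinf_union \<Omega> (s - 1)" unfolding HLinf_union_iff by blast
    from HLinf_regular[OF this s] have "V (u n) holomorphic_on \<Omega>"
      unfolding V_def[abs_def] HLinf_union_iff by (intro holomorphic_intros) auto
    moreover have "norm (V (u n) x) \<le> \<kappa> * (\<kappa> ^ n * N) * ?W x" if "x \<in> \<Omega>" for x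
      using Suc that by (intro contr[OF \<Lambda>(1)]) auto
    ultimately show ?case by (simp add: u_def mult_ac)
  qed (use w_hol N in \<open>simp add: u_def\<close>)
  define S where "S n x = (\<Sum>i<n. u i x)" for n x
  define h where "h x = (\<Sum>i. u i x)" for x
  have geo: "summable (\<lambda>i. \<kappa> ^ (i + n) * N * W)" "(\<Sum>i. \<kappa> ^ (i + n) * N * W) = \<kappa> ^ n * (N / (1 - \<kappa>)) * W" for n and W :: real
  proof -
    have "(\<lambda>i. \<kappa> ^ i * (\<kappa> ^ n * N * W)) sums (1 / (1 - \<kappa>) * (\<kappa> ^ n * N * W))"
      using \<kappa> by (intro sums_mult2 geometric_sums) auto
    then have "(\<lambda>i. \<kappa> ^ (i + n) * N * W) sums (\<kappa> ^ n * (N / (1 - \<kappa>)) * W)"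
      by (simp add: power_add mult_ac)
    then show "summable (\<lambda>i. \<kappa> ^ (i + n) * N * W)" "(\<Sum>i. \<kappa> ^ (i + n) * N * W) = \<kappa> ^ n * (N / (1 - \<kappa>)) * W"
      by (auto simp: sums_iff)
  qed
  \<comment> \<open>The geometric tail bound. It yields local uniform convergence, the weighted
    bound on \<open>h\<close> (at \<open>n = 0\<close>), and the smallness of \<open>V\<close> on
    the remainder.\<close>
  have tail: "norm (h x - S n x) \<le> \<kappa> ^ n * (N / (1 - \<kappa>)) * ?W x" if "x \<in> \<Omega>" for n x
  proof -
    have le: "norm (u i x) \<le> \<kappa> ^ i * N * ?W x" for i using u that by blast
    have "summable (\<lambda>i. u i x)"
      by (rule summable_comparison_test[OF _ geo(1)[of 0 "?W x"]]) (use le in auto)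
    then have "h x - S n x = (\<Sum>i. u (i + n) x)"
      using suminf_minus_initial_segment[of "\<lambda>i. u i x" n] by (simp add: h_def S_def)
    also have "norm \<dots> \<le> (\<Sum>i. \<kappa> ^ (i + n) * N * ?W x)"
      by (rule norm_suminf_le[OF le geo(1)])
    finally show ?thesis by (simp add: geo(2))
  qed
  have S_hol: "S n holomorphic_on \<Omega>" for n
    unfolding S_def[abs_def] using u by (intro holomorphic_intros) auto
  have lim0: "(\<lambda>n. \<kappa> ^ n * c) \<longlonglongrightarrow> 0" for c
    using tendsto_mult_right[OF LIMSEQ_power_zero, of \<kappa> c] \<kappa> by simp
  have h_hol: "h holomorphic_on \<Omega>"
  proof (rule holomorphic_uniform_sequence[OF open_\<Omega> S_hol])
    fix x assume "x \<in> \<Omega>"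
    then obtain d where d: "d > 0" "cball x d \<subseteq> \<Omega>"
      using open_\<Omega> open_contains_cball by blast
    have "continuous_on (cball x d) ?W"
      unfolding weight_def using zero_notin d by (intro continuous_intros) auto
    then have "compact (?W ` cball x d)"
      by (rule compact_continuous_image) auto
    then obtain B where B: "\<And>a. a \<in> cball x d \<Longrightarrow> \<bar>?W a\<bar> \<le> B"
      using compact_imp_bounded bounded_iff by (metis imageI real_norm_def)
    have bd: "norm (S n a - h a) \<le> \<kappa> ^ n * (\<bar>N / (1 - \<kappa>)\<bar> * B)" if "a \<in> cball x d" for n a
    proof -
      have "norm (S n a - h a) \<le> \<kappa> ^ n * (N / (1 - \<kappa>) * ?W a)"
        using tail[of a n] that d by (auto simp: norm_minus_commute mult.assoc)
      also have "\<dots> \<le> \<kappa> ^ n * (\<bar>N / (1 - \<kappa>)\<bar> * B)"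
        using B[OF that] \<kappa> by (intro mult_left_mono mult_mono abs_ge_self) auto
      finally show ?thesis .
    qed
    have "uniform_limit (cball x d) S h sequentially"
      by (intro uniform_limitI eventually_mono[OF order_tendstoD(2)[OF lim0]])
         (auto simp: dist_norm intro: le_less_trans[OF bd])
    with d show "\<exists>d>0. cball x d \<subseteq> \<Omega> \<and> uniform_limit (cball x d) S h sequentially" by blast
  qed
  have h: "h \<in> HLinf_union \<Omega> (s - 1)"
  proof -
    have "\<forall>a\<in>\<Omega>. norm (h a) \<le> N / (1 - \<kappa>) * ?W a"
      using tail[where n = 0] by (simp add: S_def)
    with h_hol show ?thesis unfolding HLinf_union_iff by blast
  qed
  have S_mem: "S n \<in> HLinf_union \<Omega> (s - 1)" for n
  proof -
    have "(\<lambda>x. h x - S n x) \<in> HLinf_union \<Omega> (s - 1)"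
      unfolding HLinf_union_iff using h_hol S_hol tail by (intro conjI holomorphic_intros) blast+
    from HLinf_union_lin(2)[OF h this] show ?thesis by simp
  qed
  have u_mem: "u n \<in> HLinf_union \<Omega> (s - 1)" for n
    unfolding HLinf_union_iff using u by blast
  have S_Suc: "S (Suc n) a = w a + V (S n) a" if a: "a \<in> \<Omega>" for n a
  proof (induction n)
    case 0
    have "S 0 = (\<lambda>x. 0)" by (simp add: S_def fun_eq_iff)
    then show ?case by (simp add: S_def u_def V_def volterra_def)
  next
    case (Suc n)
    have "S (Suc n) = (\<lambda>x. S n x + u n x)" by (simp add: S_def fun_eq_iff)
    then have "V (S (Suc n)) a = V (S n) a + u (Suc n) a"
      using V_lin(1)[OF s S_mem u_mem a] by (simp add: u_def)
    moreover have "S (Suc (Suc n)) a = S (Suc n) a + u (Suc n) a" by (simp add: S_def)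
    ultimately show ?case using Suc by simp
  qed
  have "h a = w a + V h a" if a: "a \<in> \<Omega>" for a
  proof -
    define c where "c = N / (1 - \<kappa>) * ?W a"
    \<comment> \<open>The defect is the tail after \<open>Suc n\<close> terms minus \<open>V\<close>
      of the tail after \<open>n\<close> terms; each has size at most
      \<open>\<kappa> ^ Suc n * c\<close>.\<close>
    have "norm (h a - w a - V h a) \<le> \<kappa> ^ n * (\<kappa> * c + \<kappa> * c)" for n
    proof -
      have "V (\<lambda>x. h x - S n x) a = V h a - V (S n) a"
        by (rule V_lin(2)[OF s h S_mem a])
      then have eq: "h a - w a - V h a = (h a - S (Suc n) a) - V (\<lambda>x. h x - S n x) a"
        by (simp add: S_Suc[OF a])
      have "norm (h a - w a - V h a) \<le> norm (h a - S (Suc n) a) + norm (V (\<lambda>x. h x - S n x) a)"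
        unfolding eq by (rule norm_triangle_ineq4)
      moreover have "norm (h a - S (Suc n) a) \<le> \<kappa> ^ n * (\<kappa> * c)"
        using tail[OF a, of "Suc n"] by (simp add: c_def mult_ac)
      moreover have "norm (V (\<lambda>x. h x - S n x) a) \<le> \<kappa> * (\<kappa> ^ n * (N / (1 - \<kappa>))) * ?W a"
        using h_hol S_hol by (intro contr[OF \<Lambda>(1) _ tail a] holomorphic_intros) auto
      then have "norm (V (\<lambda>x. h x - S n x) a) \<le> \<kappa> ^ n * (\<kappa> * c)"
        by (simp add: c_def mult_ac)
      ultimately show ?thesis unfolding distrib_left by linarith
    qed
    then have "norm (h a - w a - V h a) \<le> 0"
      by (intro LIMSEQ_le_const[OF lim0]) auto
    then show ?thesis by (simp add: algebra_simps)
  qed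
  with h show thesis using that by blast
qed

end

section \<open>Exponentials of primitives with a simple pole at the origin\<close>

context punctured_star
begin

lemma segment_ray:
  fixes a :: complex
  assumes "0 < t" "t \<le> 1" and x: "x \<in> closed_segment (of_real t * a) a"
  obtains u where "t \<le> u" "u \<le> 1" "x = of_real u * a"
proof -
  obtain v where v: "0 \<le> v" "v \<le> 1" and x': "x = (1 - v) *\<^sub>R (of_real t * a) + v *\<^sub>R a"
    using x by (auto simp: closed_segment_def)
  have "x = of_real (t + v * (1 - t)) * a"
    by (simp add: x' scaleR_conv_of_real algebra_simps)
  moreover have "t + v * (1 - t) \<le> 1"
    using mult_left_le_one_le[of "1 - t" v] v assms by linarith
  ultimately show thesis
    using v assms by (intro that[of "t + v * (1 - t)"]) auto
qed

text \<open>Mean value inequality on the segment from \<open>t * a\<close> to \<open>a\<close>,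
  whose length is at most \<open>norm a\<close>.\<close>

lemma ray_increment_le:
  assumes t: "0 < t" "t \<le> 1" and a: "a \<in> \<Omega>"
    and h: "\<And>x. x \<in> \<Omega> \<Longrightarrow> (h has_field_derivative h' x) (at x)"
    and C: "\<And>u. t \<le> u \<Longrightarrow> u \<le> 1 \<Longrightarrow> norm (h' (of_real u * a)) \<le> C"
  shows "norm (h a - h (of_real t * a)) \<le> C * norm a"
proof -
  have "0 \<le> C" using C[of 1] t order_trans[OF norm_ge_zero] by blast
  have "norm (h a - h (of_real t * a)) \<le> C * norm (a - of_real t * a)"
  proof (rule field_differentiable_bound[OF convex_closed_segment])
    fix x assume "x \<in> closed_segment (of_real t * a) a"
    then obtain u where u: "t \<le> u" "u \<le> 1" "x = of_real u * a"
      using segment_ray[OF t] by blast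
    show "(h has_field_derivative h' x) (at x within closed_segment (of_real t * a) a)"
      using u t ray[OF a, of u] by (auto intro: h has_field_derivative_at_within)
    show "norm (h' x) \<le> C" using C u by auto
  qed auto
  also have "a - of_real t * a = of_real (1 - t) * a" by (simp add: algebra_simps)
  also have "C * norm (of_real (1 - t) * a) \<le> C * norm a"
    unfolding norm_mult norm_of_real using t \<open>0 \<le> C\<close>
    by (intro mult_left_mono mult_left_le_one_le) auto
  finally show ?thesis .
qed

lemma bounded_near_0_if_deriv_bounded:
  assumes "connected \<Omega>" and b: "b \<in> \<Omega>" and "\<epsilon> > 0"
    and h: "\<And>x. x \<in> \<Omega> \<Longrightarrow> (h has_field_derivative h' x) (at x)"
    and C: "\<And>x. x \<in> \<Omega> \<Longrightarrow> norm x < \<epsilon> \<Longrightarrow> norm (h' x) \<le> C"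
  obtains B where "\<And>a. a \<in> \<Omega> \<Longrightarrow> norm a < \<epsilon> \<Longrightarrow> norm (h a) \<le> B"
proof -
  txt \<open>A bound on \<open>h'\<close> controls \<open>h\<close> along a single ray only. Nearby rays are compared at equal
    parameters \<open>t \<rightarrow> 0\<close>, where their distance tends to \<open>0\<close>; connectedness then links all rays.\<close>
  define R where "R x y \<longleftrightarrow> ((\<lambda>t. h (of_real t * x) - h (of_real t * y)) \<longlongrightarrow> 0) (at_right (0::real))" for x y
  have R: "R x y" if "x \<in> \<Omega>" "y \<in> \<Omega>" for x y
  proof (rule connected_equivalence_relation[OF \<open>connected \<Omega>\<close> that])
    show "R y x" if "R x y" for x y
      using tendsto_minus[OF that[unfolded R_def]] by (simp add: R_def)
    show "R x z" if "R x y" "R y z" for x y z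
      using tendsto_add[OF that[unfolded R_def]] by (simp add: R_def)
  next
    fix a assume "a \<in> \<Omega>"
    then obtain \<delta> where \<delta>: "\<delta> > 0" "ball a \<delta> \<subseteq> \<Omega>"
      using open_\<Omega> open_contains_ball by blast
    have "R a x" if x: "x \<in> ball a \<delta>" for x
    proof -
      \<comment> \<open>The bound on \<open>t\<close> keeps \<open>t * z\<close> within distance
        \<open>\<epsilon>\<close> of 0 for every \<open>z\<close> in the ball. The factor
        \<open>t\<close> from the chain rule makes the difference vanish in the limit.\<close>
      have le: "norm (h (of_real t * a) - h (of_real t * x)) \<le> C * t * norm (a - x)"
        if t: "0 < t" "t < 1" "t < \<epsilon> / (norm a + \<delta>)" for t :: real
      proof (rule field_differentiable_bound[OF convex_ball[of a \<delta>]])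
        fix z assume z: "z \<in> ball a \<delta>"
        then have tz: "of_real t * z \<in> \<Omega>" using \<delta> t by (intro ray) auto
        show "((\<lambda>z. h (of_real t * z)) has_field_derivative h' (of_real t * z) * of_real t) (at z within ball a \<delta>)"
          by (rule DERIV_chain'[where f = "\<lambda>z. of_real t * z", OF _ h[OF tz]]) (auto intro!: derivative_eq_intros)
        have "norm z \<le> norm a + \<delta>"
          using z norm_triangle_ineq2[of z a] by (auto simp: dist_norm norm_minus_commute)
        moreover have "norm a + \<delta> > 0" using \<delta> by (simp add: add_nonneg_pos)
        ultimately have "t * norm z < \<epsilon>"
          using t mult_left_mono[of "norm z" "norm a + \<delta>" t] by (simp add: field_simps)
        then have "norm (h' (of_real t * z)) \<le> C"
          using t by (intro C tz) (auto simp: norm_mult)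
        then show "norm (h' (of_real t * z) * of_real t) \<le> C * t"
          using t by (auto simp: norm_mult intro!: mult_right_mono)
      qed (use x \<delta> in auto)
      have pos: "\<epsilon> / (norm a + \<delta>) > 0" using \<delta> \<open>\<epsilon> > 0\<close> by (simp add: add_nonneg_pos)
      have "\<forall>\<^sub>F t in at_right 0. t < min 1 (\<epsilon> / (norm a + \<delta>))"
        using pos by (intro order_tendstoD(2)[OF tendsto_ident_at]) auto
      then have ev: "\<forall>\<^sub>F t in at_right 0. norm (h (of_real t * a) - h (of_real t * x)) \<le> C * t * norm (a - x)"
        using eventually_at_right_less[of 0] by eventually_elim (auto intro: le)
      have "((\<lambda>t. C * t * norm (a - x)) \<longlongrightarrow> C * 0 * norm (a - x)) (at_right (0::real))"
        by (intro tendsto_intros)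
      then show "R a x" unfolding R_def by (intro Lim_null_comparison[OF ev]) simp
    qed
    then show "\<exists>T. openin (top_of_set \<Omega>) T \<and> a \<in> T \<and> (\<forall>x\<in>T. R a x)"
      using \<delta> open_\<Omega> by (intro exI[of _ "ball a \<delta>"]) (auto simp: openin_open_eq)
  qed
  have b0: "b \<noteq> 0" using b zero_notin by auto
  define t where "t = min 1 (\<epsilon> / (2 * norm b))"
  \<comment> \<open>A reference point of norm less than \<open>\<epsilon>\<close> on the ray through
    \<open>b\<close>; all values of \<open>h\<close> near 0 are compared with
    \<open>h c\<close>.\<close>
  define c where "c = of_real t * b"
  have t: "0 < t" "t \<le> 1" "t * norm b < \<epsilon>" using \<open>\<epsilon> > 0\<close> b0 by (auto simp: t_def min_def field_simps)
  then have c: "c \<in> \<Omega>" "norm c < \<epsilon>" unfolding c_def using ray[OF b] by (auto simp: norm_mult)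
  have C0: "0 \<le> C" using order_trans[OF norm_ge_zero C[OF c]] .
  have inc: "norm (h a - h (of_real t * a)) \<le> C * \<epsilon>"
    if a: "a \<in> \<Omega>" "norm a < \<epsilon>" and t: "0 < t" "t \<le> 1" for a t
  proof -
    have "norm (h' (of_real u * a)) \<le> C" if "t \<le> u" "u \<le> 1" for u
    proof (rule C)
      show "of_real u * a \<in> \<Omega>" using that t by (intro ray a) auto
      have "norm (of_real u * a) \<le> norm a" using that t by (auto simp: norm_mult intro: mult_left_le_one_le)
      then show "norm (of_real u * a) < \<epsilon>" using a by linarith
    qed
    from ray_increment_le[OF t a(1) h this] have "norm (h a - h (of_real t * a)) \<le> C * norm a" .
    also have "\<dots> \<le> C * \<epsilon>" using a C0 by (intro mult_left_mono) auto
    finally show ?thesis .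
  qed
  \<comment> \<open>The path of comparison runs from \<open>a\<close> down its ray to
    \<open>t * a\<close>, across to \<open>t * c\<close>, and up to \<open>c\<close>;
    \<open>t\<close> is chosen so that the crossing costs less than 1.\<close>
  have "norm (h a) \<le> C * \<epsilon> + 1 + C * \<epsilon> + norm (h c)" if a: "a \<in> \<Omega>" "norm a < \<epsilon>" for a
  proof -
    have "\<forall>\<^sub>F t in at_right 0. dist (h (of_real t * a) - h (of_real t * c)) 0 < 1"
      using R[OF a(1) c(1)] unfolding R_def by (rule tendstoD) simp
    moreover have "\<forall>\<^sub>F t in at_right 0. t < (1::real)"
      by (intro order_tendstoD(2)[OF tendsto_ident_at]) auto
    ultimately have "\<forall>\<^sub>F t in at_right (0::real). 0 < t \<and> t \<le> 1 \<and> norm (h (of_real t * a) - h (of_real t * c)) < 1"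
      using eventually_at_right_less[of 0] by eventually_elim auto
    then obtain t :: real where t: "0 < t" "t \<le> 1" "norm (h (of_real t * a) - h (of_real t * c)) < 1"
      using eventually_happens[of _ "at_right (0::real)"] by (auto simp: trivial_limit_at_right_real)
    have tri: "norm (w + x - y + z) \<le> norm w + norm x + norm y + norm z" for w x y z :: complex
      using norm_triangle_ineq[of "w + x - y" z] norm_triangle_ineq4[of "w + x" y] norm_triangle_ineq[of w x]
      by linarith
    have "norm (h a) \<le> norm (h a - h (of_real t * a)) + norm (h (of_real t * a) - h (of_real t * c))
        + norm (h c - h (of_real t * c)) + norm (h c)"
      using tri[of "h a - h (of_real t * a)" "h (of_real t * a) - h (of_real t * c)" "h c - h (of_real t * c)" "h c"]
      by simp
    with inc[OF a t(1,2)] inc[OF c t(1,2)] t(3) show ?thesis by linarith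
  qed
  then show thesis using that by blast
qed

text \<open>With a branch \<open>l\<close> of the logarithm, \<open>g - \<tau> * l\<close> has
  bounded derivative near 0 and is therefore bounded there, so \<open>exp (g a)\<close> is at most
  of size \<open>norm a powr \<tau>\<close>. Farther out, \<open>g\<close> grows at most linearly
  along the ray.\<close>

lemma norm_exp_primitive_le:
  assumes "simply_connected \<Omega>" and b: "b \<in> \<Omega>" and "\<epsilon> > 0" and "\<tau> > 0"
    and g: "\<And>x. x \<in> \<Omega> \<Longrightarrow> (g has_field_derivative r x) (at x)"
    and near: "\<And>x. x \<in> \<Omega> \<Longrightarrow> norm x < \<epsilon> \<Longrightarrow> norm (r x - of_real \<tau> / x) \<le> C"
    and far: "\<And>x. x \<in> \<Omega> \<Longrightarrow> norm (r x) \<le> M / norm x"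
  obtains K \<Lambda> where "\<And>a. a \<in> \<Omega> \<Longrightarrow> norm (exp (g a)) \<le> K * weight \<tau> \<Lambda> a"
proof -
  have conn: "connected \<Omega>" using assms(1) simply_connected_imp_connected by blast
  have "(\<lambda>z. z) holomorphic_on \<Omega>" "\<forall>z\<in>\<Omega>. z \<noteq> 0" using zero_notin by auto
  \<comment> \<open>A logarithm exists because \<open>\<Omega>\<close> is simply connected and omits
    0.\<close>
  then obtain l where l: "l holomorphic_on \<Omega>" "\<And>z. z \<in> \<Omega> \<Longrightarrow> exp (l z) = z"
    using simply_connected_eq_holomorphic_log[OF open_\<Omega>] assms(1) by metis
  have dl: "(l has_field_derivative 1 / z) (at z)" if z: "z \<in> \<Omega>" for z
  proof -
    have d: "(l has_field_derivative deriv l z) (at z)"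
      using l(1) open_\<Omega> z holomorphic_derivI by blast
    have "((\<lambda>z. exp (l z)) has_field_derivative exp (l z) * deriv l z) (at z)"
      by (rule DERIV_chain'[OF d DERIV_exp])
    moreover have "((\<lambda>z. exp (l z)) has_field_derivative 1) (at z)"
      by (rule has_field_derivative_transform_within_open[OF DERIV_ident open_\<Omega> z]) (simp add: l)
    ultimately have "z * deriv l z = 1" using DERIV_unique l(2)[OF z] by fastforce
    moreover have "z \<noteq> 0" using z zero_notin by auto
    ultimately have "deriv l z = 1 / z" by (simp add: field_simps)
    with d show ?thesis by simp
  qed
  have dh: "((\<lambda>x. g x - of_real \<tau> * l x) has_field_derivative (r x - of_real \<tau> / x)) (at x)" if "x \<in> \<Omega>" for x
    using g[OF that] dl[OF that] by (auto intro!: derivative_eq_intros)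
  obtain B where B: "\<And>a. a \<in> \<Omega> \<Longrightarrow> norm a < \<epsilon> \<Longrightarrow> norm (g a - of_real \<tau> * l a) \<le> B"
    using bounded_near_0_if_deriv_bounded[OF conn b \<open>\<epsilon> > 0\<close> dh near] by blast
  have near_le: "norm (exp (g a)) \<le> exp B * norm a powr \<tau>" if a: "a \<in> \<Omega>" "norm a < \<epsilon>" for a
  proof -
    have "exp (g a) = exp (g a - of_real \<tau> * l a) * exp (of_real \<tau> * l a)"
      by (simp flip: exp_add)
    moreover have "norm (exp (of_real \<tau> * l a)) = norm (exp (l a)) powr \<tau>"
      by (simp add: exp_powr_real mult.commute)
    moreover have "norm (exp (g a - of_real \<tau> * l a)) \<le> exp B"
      using B[OF a] complex_Re_le_cmod[of "g a - of_real \<tau> * l a"] by simp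
    ultimately show ?thesis
      using l(2)[OF a(1)] by (simp add: norm_mult mult_right_mono del: norm_exp_eq_Re)
  qed
  \<comment> \<open>A bound for \<open>norm (r x)\<close> on the points of \<open>\<Omega>\<close>
    with \<open>norm x \<ge> \<epsilon> / 2\<close>.\<close>
  define \<Lambda> where "\<Lambda> = 2 * \<bar>M\<bar> / \<epsilon>"
  have "norm (exp (g a)) \<le> exp B * weight \<tau> \<Lambda> a" if a: "a \<in> \<Omega>" for a
  proof (cases "norm a < \<epsilon>")
    case True
    have "norm a powr \<tau> * 1 \<le> weight \<tau> \<Lambda> a"
      unfolding weight_def using \<open>\<epsilon> > 0\<close> by (intro mult_left_mono) (auto simp: \<Lambda>_def)
    then show ?thesis using near_le[OF a True] mult_left_mono[of _ _ "exp B"] order_trans by fastforce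
  next
    case False
    have a0: "norm a > 0" using a zero_notin by auto
    \<comment> \<open>The ray is followed back to the point of norm \<open>\<epsilon> / 2\<close>,
      where the estimate near 0 applies.\<close>
    define t where "t = \<epsilon> / (2 * norm a)"
    have t: "0 < t" "t \<le> 1" and na: "t * norm a = \<epsilon> / 2"
      using False \<open>\<epsilon> > 0\<close> a0 by (auto simp: t_def field_simps)
    define c where "c = of_real t * a"
    have c: "c \<in> \<Omega>" "norm c = \<epsilon> / 2" using ray[OF a t] t na by (auto simp: c_def norm_mult)
    have "norm (r (of_real u * a)) \<le> \<Lambda>" if u: "t \<le> u" "u \<le> 1" for u
    proof -
      have "norm (r (of_real u * a)) \<le> M / norm (of_real u * a)"
        using u t by (intro far ray a) auto
      also have "\<dots> \<le> \<bar>M\<bar> / (\<epsilon> / 2)"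
      proof (rule frac_le)
        have "t * norm a \<le> u * norm a" using u by (intro mult_right_mono) auto
        then show "\<epsilon> / 2 \<le> norm (of_real u * a)" using u t na by (simp add: norm_mult)
      qed (use \<open>\<epsilon> > 0\<close> in auto)
      finally show ?thesis by (simp add: \<Lambda>_def mult.commute)
    qed
    from ray_increment_le[OF t a g this] have "norm (g a - g c) \<le> \<Lambda> * norm a" by (simp add: c_def)
    then have "norm (exp (g a - g c)) \<le> exp (\<Lambda> * norm a)"
      using complex_Re_le_cmod[of "g a - g c"] by simp
    moreover have "norm (exp (g c)) \<le> exp B * norm a powr \<tau>"
    proof -
      have "norm c powr \<tau> \<le> norm a powr \<tau>"
        using c False \<open>\<epsilon> > 0\<close> \<open>\<tau> > 0\<close> by (intro powr_mono2) auto
      then have "exp B * norm c powr \<tau> \<le> exp B * norm a powr \<tau>" by simp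
      moreover have "norm (exp (g c)) \<le> exp B * norm c powr \<tau>" using c \<open>\<epsilon> > 0\<close> by (intro near_le) auto
      ultimately show ?thesis by linarith
    qed
    moreover have "exp (g a) = exp (g c) * exp (g a - g c)" by (simp flip: exp_add)
    ultimately have "norm (exp (g a)) \<le> (exp B * norm a powr \<tau>) * exp (\<Lambda> * norm a)"
      by (simp only: norm_mult) (rule mult_mono, auto)
    then show ?thesis by (simp add: weight_def mult.assoc)
  qed
  then show thesis using that by blast
qed

end

text \<open>Connectedness supplies a valid path, so \<open>SOME\<close> selects a genuine one; a
  primitive gives the same value on every such path.\<close>

lemma integral_in_primitive:
  assumes "open \<Omega>" "connected \<Omega>" "a \<in> \<Omega>" "b \<in> \<Omega>"
    and g: "\<And>x. x \<in> \<Omega> \<Longrightarrow> (g has_field_derivative r x) (at x)"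
  shows "integral_in \<Omega> b a r = g a - g b"
proof -
  let ?P = "\<lambda>\<gamma>. valid_path \<gamma> \<and> path_image \<gamma> \<subseteq> \<Omega> \<and> pathstart \<gamma> = b \<and> pathfinish \<gamma> = a"
  have "\<exists>\<gamma>. ?P \<gamma>"
    using connected_open_polynomial_connected[OF assms(1,2,4,3)] valid_path_polynomial_function by metis
  then have *: "?P (SOME \<gamma>. ?P \<gamma>)" by (rule someI_ex)
  have "(r has_contour_integral (g a - g b)) (SOME \<gamma>. ?P \<gamma>)"
    using contour_integral_primitive[of \<Omega> g r "SOME \<gamma>. ?P \<gamma>"] * has_field_derivative_at_within[OF g]
    by auto
  then show ?thesis unfolding integral_in_def by (rule contour_integral_unique)
qed

section \<open>The reference solution and the theorem\<close>

locale volterra_kernel_pq = volterra_pair \<Omega> "kernel0 p q" ks \<tau> \<gamma> \<nu> M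
  for \<Omega> p q ks \<tau> \<gamma> \<nu> M +
  fixes b :: complex
  assumes sc: "simply_connected \<Omega>" and b: "b \<in> \<Omega>"
    and p: "p holomorphic_on \<Omega>" and q: "q holomorphic_on \<Omega>"
    and p_nz: "(\<exists>a\<in>\<Omega>. q a \<noteq> 0) \<Longrightarrow> (\<forall>a\<in>\<Omega>. p a \<noteq> 0)"
    and diag: "\<exists>U. open U \<and> 0 \<in> U \<and> bounded ((\<lambda>a. kernel0 p q a a - of_real \<tau> / a) ` (U \<inter> \<Omega>))"
begin

abbreviation "f0 \<equiv> f0_fun \<Omega> p q b"

lemma diag_bound:
  obtains \<epsilon> C where "\<epsilon> > 0"
    "\<And>a. a \<in> \<Omega> \<Longrightarrow> norm a < \<epsilon> \<Longrightarrow> norm (kernel0 p q a a - of_real \<tau> / a) \<le> C"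
proof -
  obtain U where "open U" "0 \<in> U" and U: "bounded ((\<lambda>a. kernel0 p q a a - of_real \<tau> / a) ` (U \<inter> \<Omega>))"
    using diag by blast
  then obtain \<epsilon> where \<epsilon>: "\<epsilon> > 0" "ball 0 \<epsilon> \<subseteq> U"
    using open_contains_ball by blast
  obtain C where C: "\<And>a. a \<in> U \<inter> \<Omega> \<Longrightarrow> norm (kernel0 p q a a - of_real \<tau> / a) \<le> C"
    using U unfolding bounded_iff by blast
  have "norm (kernel0 p q a a - of_real \<tau> / a) \<le> C" if "a \<in> \<Omega>" "norm a < \<epsilon>" for a
    by (rule C) (use that \<epsilon> in \<open>auto simp: subset_iff\<close>)
  with \<epsilon> show thesis using that by blast
qed

text \<open>If \<open>q\<close> vanished on \<open>\<Omega>\<close>, so would the kernel, and the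
  diagonal condition would bound \<open>\<tau> / a\<close> near 0.\<close>

lemma ex_q_nz: "\<exists>a\<in>\<Omega>. q a \<noteq> 0"
proof (rule ccontr)
  assume "\<not> (\<exists>a\<in>\<Omega>. q a \<noteq> 0)"
  then have q0: "q a = 0" if "a \<in> \<Omega>" for a using that by blast
  obtain \<epsilon> C where \<epsilon>: "\<epsilon> > 0"
    and C: "\<And>a. a \<in> \<Omega> \<Longrightarrow> norm a < \<epsilon> \<Longrightarrow> norm (kernel0 p q a a - of_real \<tau> / a) \<le> C"
    using diag_bound by blast
  have b0: "norm b > 0" using b zero_notin by auto
  \<comment> \<open>The entries keep the point on the ray through \<open>b\<close> inside
    \<open>\<Omega>\<close>, place it where the bound \<open>C\<close> holds, and make
    \<open>\<tau> / r\<close> exceed \<open>C\<close>.\<close>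
  define r where "r = Min {norm b, \<epsilon> / 2, \<tau> / (\<bar>C\<bar> + 1)}"
  have r: "0 < r" using b0 \<epsilon> \<tau> by (simp add: r_def)
  have r_le: "r \<le> norm b" "r \<le> \<epsilon> / 2" "r \<le> \<tau> / (\<bar>C\<bar> + 1)"
    unfolding r_def by (rule Min_le; simp)+
  define a where "a = of_real (r / norm b) * b"
  have a: "a \<in> \<Omega>" unfolding a_def using r r_le b0 by (intro ray b) auto
  have na: "norm a = r" using r b0 by (simp add: a_def norm_mult norm_divide)
  have "\<tau> / r \<le> C"
    using C[OF a] r r_le \<epsilon> \<tau> by (simp add: kernel0_def q0[OF a] na norm_divide)
  moreover have "\<bar>C\<bar> + 1 \<le> \<tau> / r"
    using r r_le by (simp add: field_simps)
  ultimately show False by linarith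
qed

lemma p_nonzero: "a \<in> \<Omega> \<Longrightarrow> p a \<noteq> 0"
  using p_nz[OF ex_q_nz] by blast

text \<open>Freezing the second argument at a point \<open>c\<close> with
  \<open>q c \<noteq> 0\<close> turns the bound on the kernel into a bound on
  \<open>1 / p\<close>.\<close>

lemma inverse_p_le:
  obtains K where "\<And>a. a \<in> \<Omega> \<Longrightarrow> norm (1 / p a) \<le> K * weight (-1) \<bar>\<nu>\<bar> a"
proof -
  obtain c where c: "c \<in> \<Omega>" "q c \<noteq> 0" using ex_q_nz by blast
  have "norm (1 / p a) \<le> M / norm (q c) * exp (\<bar>\<nu>\<bar> * norm c) * weight (-1) \<bar>\<nu>\<bar> a" if a: "a \<in> \<Omega>" for a
  proof -
    have a0: "norm a > 0" using a zero_notin by auto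
    have "norm (kernel0 p q a c) \<le> M / norm a * exp (\<nu> * norm (a - c))" by (rule k0_bound[OF a c(1)])
    also have "\<nu> * norm (a - c) \<le> \<bar>\<nu>\<bar> * (norm a + norm c)"
      by (intro mult_mono norm_triangle_ineq4) auto
    then have "M / norm a * exp (\<nu> * norm (a - c)) \<le> M / norm a * exp (\<bar>\<nu>\<bar> * (norm a + norm c))"
      using M_nonneg by (intro mult_left_mono) auto
    finally have "norm (q c) * norm (1 / p a) \<le> M / norm a * exp (\<bar>\<nu>\<bar> * (norm a + norm c))"
      by (simp add: kernel0_def norm_divide)
    then have "norm (1 / p a) \<le> M / norm a * exp (\<bar>\<nu>\<bar> * (norm a + norm c)) / norm (q c)"
      using divide_right_mono[of _ _ "norm (q c)"] c by fastforce
    then show ?thesis using a0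
      by (simp add: weight_def powr_minus_divide distrib_left exp_add mult_ac)
  qed
  then show thesis using that by blast
qed

text \<open>Replaces the path integral by a global primitive \<open>g\<close> of the diagonal kernel
  \<open>- q / p\<close>, which exists by simple connectedness and is normalised by
  \<open>g b = 0\<close>.\<close>

lemma f0_primitive:
  obtains g where "\<And>x. x \<in> \<Omega> \<Longrightarrow> (g has_field_derivative kernel0 p q x x) (at x)"
    "\<And>a. a \<in> \<Omega> \<Longrightarrow> f0 a = exp (g a) / p a"
proof -
  have "(\<lambda>x. q x / p x) holomorphic_on \<Omega>"
    using p q p_nonzero by (intro holomorphic_intros) auto
  then obtain h where h: "\<And>x. x \<in> \<Omega> \<Longrightarrow> (h has_field_derivative q x / p x) (at x)"
    using simply_connected_eq_global_primitive[OF open_\<Omega>] sc by metis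
  show thesis
  proof
    fix x assume x: "x \<in> \<Omega>"
    show "((\<lambda>x. h b - h x) has_field_derivative kernel0 p q x x) (at x)"
      using h[OF x] by (auto intro!: derivative_eq_intros simp: kernel0_def)
    have "integral_in \<Omega> b x (\<lambda>s. q s / p s) = h x - h b"
      using h by (intro integral_in_primitive open_\<Omega> simply_connected_imp_connected sc b x)
    then show "f0 x = exp (h b - h x) / p x"
      by (simp add: f0_fun_def)
  qed
qed

text \<open>The growth bound multiplies \<open>norm a powr \<tau>\<close> from \<open>exp g\<close>
  with \<open>1 / norm a\<close> from \<open>1 / p\<close>. The fixed-point equation is the
  fundamental theorem of calculus for \<open>exp g = p * f0\<close> along the ray, with boundary
  value 0 at the origin.\<close>

lemma f0_properties:
  shows f0_mem: "f0 \<in> HLinf_union \<Omega> (\<tau> - 1)"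
    and f0_fixed: "\<And>a. a \<in> \<Omega> \<Longrightarrow> volterra (kernel0 p q) f0 a = f0 a"
proof -
  obtain g where g: "\<And>x. x \<in> \<Omega> \<Longrightarrow> (g has_field_derivative kernel0 p q x x) (at x)"
    and f0: "\<And>a. a \<in> \<Omega> \<Longrightarrow> f0 a = exp (g a) / p a"
    using f0_primitive by blast
  obtain \<epsilon> C where \<epsilon>: "\<epsilon> > 0"
    "\<And>a. a \<in> \<Omega> \<Longrightarrow> norm a < \<epsilon> \<Longrightarrow> norm (kernel0 p q a a - of_real \<tau> / a) \<le> C"
    using diag_bound by blast
  have far: "norm (kernel0 p q x x) \<le> M / norm x" if "x \<in> \<Omega>" for x
    using k0_bound[OF that that] by simp
  obtain K \<Lambda> where K: "\<And>a. a \<in> \<Omega> \<Longrightarrow> norm (exp (g a)) \<le> K * weight \<tau> \<Lambda> a"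
    using norm_exp_primitive_le[OF sc b \<epsilon>(1) \<tau> g \<epsilon>(2) far] by blast
  obtain K' where K': "\<And>a. a \<in> \<Omega> \<Longrightarrow> norm (1 / p a) \<le> K' * weight (-1) \<bar>\<nu>\<bar> a"
    using inverse_p_le by blast
  have "norm (f0 a) \<le> K * K' * weight (\<tau> - 1) (\<Lambda> + \<bar>\<nu>\<bar>) a" if a: "a \<in> \<Omega>" for a
  proof -
    have "norm (f0 a) = norm (exp (g a)) * norm (1 / p a)" by (simp add: f0[OF a] norm_divide)
    also have "\<dots> \<le> (K * weight \<tau> \<Lambda> a) * (K' * weight (-1) \<bar>\<nu>\<bar> a)"
      using order_trans[OF norm_ge_zero K[OF a]] by (intro mult_mono K K' a) auto
    also have "\<dots> = K * K' * weight (\<tau> - 1) (\<Lambda> + \<bar>\<nu>\<bar>) a"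
      using a zero_notin by (auto simp: weight_def powr_add exp_add distrib_right powr_diff powr_minus_divide)
    finally show ?thesis .
  qed
  moreover have "f0 holomorphic_on \<Omega>"
  proof (rule holomorphic_transform[of "\<lambda>a. exp (g a) / p a"])
    have "g holomorphic_on \<Omega>" using g holomorphic_on_open[OF open_\<Omega>] by blast
    then show "(\<lambda>a. exp (g a) / p a) holomorphic_on \<Omega>"
      using p p_nonzero by (intro holomorphic_intros) auto
  qed (simp add: f0)
  ultimately show "f0 \<in> HLinf_union \<Omega> (\<tau> - 1)"
    unfolding HLinf_union_iff by blast

  fix a assume a: "a \<in> \<Omega>"
  \<comment> \<open>The value 0 at \<open>t = 0\<close> is the continuous extension of
    \<open>exp (g (t * a))\<close>; continuity there comes from the bound by
    \<open>t powr \<tau>\<close> with \<open>\<tau> > 0\<close>.\<close>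
  define F where "F t = (if t = 0 then 0 else exp (g (of_real t * a)))" for t :: real
  have dF: "(F has_vector_derivative exp (g (of_real t * a)) * (kernel0 p q (of_real t * a) (of_real t * a) * a)) (at t)"
    if t: "0 < t" "t \<le> 1" for t
  proof -
    have v: "((\<lambda>t. of_real t * a) has_vector_derivative a) (at t)"
      by (auto intro!: derivative_eq_intros simp: has_vector_derivative_def scaleR_conv_of_real)
    have "((\<lambda>x. exp (g x)) has_field_derivative
        exp (g (of_real t * a)) * kernel0 p q (of_real t * a) (of_real t * a)) (at (of_real t * a))"
      by (rule DERIV_chain'[OF g[OF ray[OF a t]] DERIV_exp])
    from field_vector_diff_chain_at[OF v this]
    have "((\<lambda>t. exp (g (of_real t * a))) has_vector_derivative
        exp (g (of_real t * a)) * (kernel0 p q (of_real t * a) (of_real t * a) * a)) (at t)"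
      by (simp only: o_def mult.commute[of a] mult.assoc)
    then show ?thesis
      by (rule has_vector_derivative_transform_within_open[of _ _ _ "{0<..}"])
         (use t in \<open>auto simp: F_def\<close>)
  qed
  have "continuous_on {0..1} F"
    unfolding continuous_on_eq_continuous_within
  proof
    fix t :: real assume t: "t \<in> {0..1}"
    show "continuous (at t within {0..1}) F"
    proof (cases "t = 0")
      case True
      have "norm (F u) \<le> K * (u powr \<tau> * norm a powr \<tau> * exp (\<Lambda> * (u * norm a)))" if "u \<ge> 0" "u \<le> 1" for u
        using K[OF ray[OF a, of u]] that by (auto simp: F_def weight_def norm_mult powr_mult)
      then have ev: "\<forall>\<^sub>F u in at 0 within {0..1}. norm (F u) \<le> K * (u powr \<tau> * norm a powr \<tau> * exp (\<Lambda> * (u * norm a)))"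
        by (auto simp: eventually_at_filter)
      have "((\<lambda>u. K * (u powr \<tau> * norm a powr \<tau> * exp (\<Lambda> * (u * norm a)))) \<longlongrightarrow>
          K * (0 powr \<tau> * norm a powr \<tau> * exp (\<Lambda> * (0 * norm a)))) (at 0 within {0..1})"
        by (intro tendsto_intros) (use \<tau> in \<open>auto simp: eventually_at_filter\<close>)
      then have "(F \<longlongrightarrow> 0) (at 0 within {0..1})"
        by (intro Lim_null_comparison[OF ev]) simp
      then show ?thesis using True by (simp add: continuous_within F_def)
    next
      case False
      with t have "0 < t" "t \<le> 1" by auto
      from has_vector_derivative_continuous[OF dF[OF this]] show ?thesis
        by (rule continuous_at_imp_continuous_at_within)
    qed
  qed
  then have "((\<lambda>t. exp (g (of_real t * a)) * (kernel0 p q (of_real t * a) (of_real t * a) * a)) has_integral (F 1 - F 0)) {0..1}"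
    by (intro fundamental_theorem_of_calculus_interior dF) auto
  then have "((\<lambda>t. 1 / p a * (exp (g (of_real t * a)) * (kernel0 p q (of_real t * a) (of_real t * a) * a))) has_integral f0 a) {0..1}"
    using has_integral_mult_right[of _ "exp (g a)" _ "1 / p a"] by (simp add: F_def f0[OF a])
  \<comment> \<open>The product form of the kernel lets \<open>p (t * a)\<close> and
    \<open>p a\<close> trade places: \<open>f0\<close> carries the first as denominator, the kernel
    the second. The point \<open>t = 0\<close> is removed since 0 is outside
    \<open>\<Omega>\<close>.\<close>
  then have "((\<lambda>t. kernel0 p q a (of_real t * a) * f0 (of_real t * a) * a) has_integral f0 a) {0..1}"
  proof (rule has_integral_spike_finite[of "{0}", rotated 2])
    fix t :: real assume "t \<in> {0..1} - {0}"
    then have "of_real t * a \<in> \<Omega>" by (intro ray a) auto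
    then show "kernel0 p q a (of_real t * a) * f0 (of_real t * a) * a
        = 1 / p a * (exp (g (of_real t * a)) * (kernel0 p q (of_real t * a) (of_real t * a) * a))"
      by (simp add: f0 kernel0_def)
  qed simp
  then show "volterra (kernel0 p q) f0 a = f0 a"
    unfolding volterra_eq_integral by (rule integral_unique)
qed

lemma affine_subset: "affine_HL \<Omega> f0 (\<tau> - 1 + \<gamma>) \<subseteq> HLinf_union \<Omega> (\<tau> - 1)"
  unfolding affine_HL_def using HLinf_union_add_subset[OF \<gamma>] HLinf_union_lin(1)[OF f0_mem] by blast

text \<open>In this space both integrals converge, so the integrability clauses hold automatically
  and only the equation remains.\<close>

lemma volterra_solution_iff:
  assumes "f \<in> HLinf_union \<Omega> (\<tau> - 1)"
  shows "volterra_solution \<Omega> (kernel0 p q) ks f \<longleftrightarrow> (\<forall>a\<in>\<Omega>. f a = V f a)"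
  using HLinf_regular(3,4)[OF assms \<tau>] by (auto simp: volterra_solution_def V_def)

text \<open>The contraction requires an exponent parameter above \<open>\<tau>\<close>, and
  \<open>\<tau> + \<gamma>\<close> qualifies. Hence the fixed-point argument is applied to the
  correction \<open>h\<close> to \<open>f0\<close>, with source term
  \<open>volterra ks f0\<close>.\<close>

lemma solution_exists_unique:
  "\<exists>f \<in> affine_HL \<Omega> f0 (\<tau> - 1 + \<gamma>). volterra_solution \<Omega> (kernel0 p q) ks f \<and>
     (\<forall>g \<in> affine_HL \<Omega> f0 (\<tau> - 1 + \<gamma>). volterra_solution \<Omega> (kernel0 p q) ks g \<longrightarrow> (\<forall>a\<in>\<Omega>. g a = f a))"
proof -
  have s: "\<tau> + \<gamma> > \<tau>" and s1: "\<tau> - 1 + \<gamma> = (\<tau> + \<gamma>) - 1" using \<gamma> by auto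
  have "volterra ks f0 \<in> HLinf_union \<Omega> ((\<tau> + \<gamma>) - 1)"
    using HLinf_regular(2)[OF f0_mem \<tau>] unfolding s1 .
  then obtain h where h: "h \<in> HLinf_union \<Omega> ((\<tau> + \<gamma>) - 1)" "\<And>a. a \<in> \<Omega> \<Longrightarrow> h a = volterra ks f0 a + V h a"
    using V_resolvent[OF s] by blast
  define f where "f = (\<lambda>a. f0 a + h a)"
  have f: "f \<in> affine_HL \<Omega> f0 (\<tau> - 1 + \<gamma>)"
    unfolding affine_HL_def f_def s1 using h(1) by blast
  then have f_mem: "f \<in> HLinf_union \<Omega> (\<tau> - 1)" using affine_subset by blast
  have h_mem: "h \<in> HLinf_union \<Omega> (\<tau> - 1)"
    using h(1) HLinf_union_add_subset[OF \<gamma>, of "\<tau> - 1"] unfolding s1 by blast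
  have "f a = V f a" if a: "a \<in> \<Omega>" for a
  proof -
    have "V f a = V f0 a + V h a" unfolding f_def by (rule V_lin(1)[OF \<tau> f0_mem h_mem a])
    also have "V f0 a = f0 a + volterra ks f0 a" by (simp add: V_def f0_fixed[OF a])
    finally show ?thesis by (simp add: f_def h(2)[OF a])
  qed
  then have fsol: "\<forall>a\<in>\<Omega>. f a = V f a" by blast
  show ?thesis
  proof (intro bexI[OF _ f] conjI ballI impI)
    show "volterra_solution \<Omega> (kernel0 p q) ks f"
      using fsol by (simp add: volterra_solution_iff[OF f_mem])
    fix g a assume g: "g \<in> affine_HL \<Omega> f0 (\<tau> - 1 + \<gamma>)" and a: "a \<in> \<Omega>"
    have g_mem: "g \<in> HLinf_union \<Omega> (\<tau> - 1)" using affine_subset g by blast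
    assume "volterra_solution \<Omega> (kernel0 p q) ks g"
    then have gsol: "\<forall>a\<in>\<Omega>. g a = V g a" by (simp add: volterra_solution_iff[OF g_mem])
    obtain h' where h': "h' \<in> HLinf_union \<Omega> ((\<tau> + \<gamma>) - 1)" "g = (\<lambda>a. f0 a + h' a)"
      using g unfolding affine_HL_def s1 by blast
    \<comment> \<open>Subtraction cancels \<open>f0\<close>, which places the difference of two
      solutions in the smaller space where \<open>V_unique\<close> applies.\<close>
    have "(\<lambda>x. g x - f x) = (\<lambda>x. h' x - h x)" by (simp add: h' f_def)
    then have d: "(\<lambda>x. g x - f x) \<in> HLinf_union \<Omega> ((\<tau> + \<gamma>) - 1)"
      using HLinf_union_lin(2)[OF h'(1) h(1)] by simp
    have "g x - f x = V (\<lambda>x. g x - f x) x" if "x \<in> \<Omega>" for x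
      using V_lin(2)[OF \<tau> g_mem f_mem that] fsol gsol that by simp
    from V_unique[OF s d this a] show "g a = f a" by simp
  qed
qed

end

theorem theorem1p6:
  fixes \<Omega> :: "complex set"
    and p q :: "complex \<Rightarrow> complex"
    and kstar :: "complex \<Rightarrow> complex \<Rightarrow> complex"
    and \<tau> \<gamma> lamD M :: real
    and b :: complex
  assumes "open \<Omega>" and "simply_connected \<Omega>" and "0 \<notin> \<Omega>" and "0 \<in> closure \<Omega>"
    and "star_shaped_0 \<Omega>"
    and "p holomorphic_on \<Omega>" and "q holomorphic_on \<Omega>"
    and "(\<exists>a\<in>\<Omega>. q a \<noteq> 0) \<Longrightarrow> (\<forall>a\<in>\<Omega>. p a \<noteq> 0)"
    and "(\<lambda>(a, a'). kernel0 p q a a') holomorphic2_on \<Omega> \<times> \<Omega>"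
    and "(\<lambda>(a, a'). kstar a a') holomorphic2_on \<Omega> \<times> \<Omega>"
    and "\<tau> > 0" and "\<gamma> > 0"
    and "\<exists>U. open U \<and> 0 \<in> U \<and> bounded ((\<lambda>a. kernel0 p q a a - of_real \<tau> / a) ` (U \<inter> \<Omega>))"
    and "\<And>\<sigma>::real. \<sigma> > \<tau> \<Longrightarrow>
           \<exists>U. open U \<and> (0, 0) \<in> U \<and>
               (\<forall>(a, a') \<in> U \<inter> \<Omega> \<times> \<Omega>. norm (kernel0 p q a a') < \<sigma> / norm a)"
    and "\<And>a a'. a \<in> \<Omega> \<Longrightarrow> a' \<in> \<Omega> \<Longrightarrow>
           norm (kernel0 p q a a') \<le> M / norm a * exp (lamD * norm (a - a'))"
    and "\<And>a a'. a \<in> \<Omega> \<Longrightarrow> a' \<in> \<Omega> \<Longrightarrow>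
           norm (kstar a a') \<le> M * (norm (a - a') powr \<gamma> / norm a) * exp (lamD * norm (a - a'))"
    and "b \<in> \<Omega>"
  shows "f0_fun \<Omega> p q b \<in> HLinf_union \<Omega> (\<tau> - 1)
    \<and> affine_HL \<Omega> (f0_fun \<Omega> p q b) (\<tau> - 1 + \<gamma>) \<subseteq> HLinf_union \<Omega> (\<tau> - 1)
    \<and> (\<exists>f \<in> affine_HL \<Omega> (f0_fun \<Omega> p q b) (\<tau> - 1 + \<gamma>).
          volterra_solution \<Omega> (kernel0 p q) kstar f \<and>
          (\<forall>g \<in> affine_HL \<Omega> (f0_fun \<Omega> p q b) (\<tau> - 1 + \<gamma>).
             volterra_solution \<Omega> (kernel0 p q) kstar g \<longrightarrow> (\<forall>a\<in>\<Omega>. g a = f a)))"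
proof -
  have "\<Omega> \<noteq> {}" using \<open>b \<in> \<Omega>\<close> by blast
  interpret volterra_kernel_pq \<Omega> p q kstar \<tau> \<gamma> lamD M b
    by unfold_locales (fact assms \<open>\<Omega> \<noteq> {}\<close>)+
  show ?thesis
    using f0_mem affine_subset solution_exists_unique by blast
qed

end
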